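(* There exists a constant $C > 0$ such that $$\mathrm{tcl}(G \cup \mathbb{G}(n,p)) \geq \min\left\{ \frac{\delta(G)}{8},\; \sqrt{\frac{n}{60 \log_2 n}} \right\}$$ holds asymptotically almost surely whenever $p := p(n) \geq C/n$ and $G$ is an $n$-vertex graph satisfying $\delta(G) = \omega(1)$.
   Context: $\mathbb{G}(n,p)$ is the binomial random graph on the same $n$-element vertex set as $G$ (each pair is an edge independently with probability $p$), and $G \cup \mathbb{G}(n,p)$ is the random graph $G \cup R$ (union of edge sets) with $R \sim \mathbb{G}(n,p)$. Subdividing an edge means removing it and adding a new vertex of degree two adjacent exactly to the two ends of that edge. A graph $H$ is a subdivision of $K$ if it can be obtained from $K$ by repeatedly subdividing edges. $\mathrm{tcl}(K)$ denotes the largest integer $r$ such that $K$ contains a subdivision of the complete graph $K_r$ as a subgraph. $\delta(G)$ is the minimum degree of $G$; $\delta(G)=\omega(1)$ means $\delta(G_n) \to \infty$ as $n \to \infty$ for the sequence of graphs $G = G_n$ considered. "Asymptotically almost surely" means with probability tending to $1$ as $n \to \infty$. The paper omits floor and ceiling signs whenever they are not crucial. *)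

theory Defs
  imports "HOL-Probability.Probability" "Graph_Theory.Kuratowski"
begin

text \<open>
  A finite simple graph is an irreflexive symmetric digraph on a finite vertex set
  (locale \<^locale>\<open>pair_graph\<close>): an edge is a pair of opposite arcs, so the degree of a vertex
  is its out-degree.
\<close>

definition min_degree :: "('a, 'b) pre_digraph \<Rightarrow> nat" where
  "min_degree G = Min (out_degree G ` verts G)"

text \<open>
  Subdividing adds vertices and never renames old ones, so the branch vertices of a subdivision
  \<open>H\<close> of \<open>K\<close> are the vertices of \<open>K\<close>; quantifying over all complete graphs \<open>K\<close> on \<open>r\<close> vertices
  of the vertex type therefore covers all copies of subdivisions of the complete graph of order \<open>r\<close>.
\<close>

definition contains_clique_subdivision :: "('a, 'b) pre_digraph \<Rightarrow> nat \<Rightarrow> bool" where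
  "contains_clique_subdivision G r \<longleftrightarrow>
     (\<exists>H K rev_K rev_H. subgraph H G \<and> subdivision (K, rev_K) (H, rev_H) \<and> complete_digraph r K)"

definition tcl :: "('a, 'b) pre_digraph \<Rightarrow> nat" where
  "tcl G = Max {r. contains_clique_subdivision G r}"

text \<open>The set in the definition of \<^const>\<open>tcl\<close> is finite and nonempty, so the maximum is genuine.\<close>

lemma contains_clique_subdivision_le:
  assumes "contains_clique_subdivision G r" "finite (verts G)"
  shows "r \<le> card (verts G)"
proof -
  obtain H K rev_K rev_H where *: "subgraph H G" "subdivision (K, rev_K) (H, rev_H)"
    "complete_digraph r K"
    using assms(1) by (auto simp: contains_clique_subdivision_def)
  have "verts K \<subseteq> verts G"
    using subdivision_verts_subset[OF *(2)] *(1) by (auto simp: subgraph_def)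
  with assms(2) *(3) show ?thesis
    by (auto simp: complete_digraph_def intro: card_mono)
qed

lemma finite_clique_subdivision_orders:
  "finite (verts G) \<Longrightarrow> finite {r. contains_clique_subdivision G r}"
  by (rule finite_subset[of _ "{..card (verts G)}"]) (auto dest: contains_clique_subdivision_le)

lemma contains_clique_subdivision_0:
  assumes "wf_digraph G"
  shows "contains_clique_subdivision G 0"
proof -
  let ?H = "\<lparr>verts = {}, arcs = {}, tail = tail G, head = head G\<rparr>"
  have "subgraph ?H G"
    using assms by (auto simp: subgraph_def compatible_def wf_digraph_def)
  moreover have "subdivision (?H, id) (?H, id)"
    by (rule subdivision_base) (unfold_locales, auto)
  moreover have "complete_digraph 0 ?H"
    unfolding complete_digraph_def by (auto simp: arcs_ends_def symmetric_def sym_def, unfold_locales)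
      (auto simp: arcs_ends_def symmetric_def sym_def)
  ultimately show ?thesis
    by (auto simp: contains_clique_subdivision_def)
qed

definition binomial_random_graph :: "'a set \<Rightarrow> real \<Rightarrow> 'a pair_pre_digraph pmf" where
  "binomial_random_graph V p =
     map_pmf (\<lambda>X. \<lparr>pverts = V, parcs = {(u, v). u \<in> V \<and> v \<in> V \<and> u \<noteq> v \<and> X {u, v}}\<rparr>)
       (Pi_pmf {e. e \<subseteq> V \<and> card e = 2} False (\<lambda>_. bernoulli_pmf p))"

end

theory Submission
  imports Defs "HOL-Real_Asymp.Real_Asymp"
begin

text \<open>
  Let \<open>r\<close> be the target order. Since the minimum degree is about \<open>8 r\<close> and \<open>n\<close> is much larger
  than \<open>r\<^sup>2\<close>, the graph \<open>G\<close> contains \<open>r\<close> disjoint stars with \<open>2 r\<close> leaves each; their centres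
  become the branch vertices, and all connections between leaves are made inside the random graph.

  For \<open>p = C / n\<close> with \<open>C\<close> large, any two disjoint sets of \<open>m \<approx> n / 64\<close> vertices are almost surely
  joined by an edge of the random graph. Fix a set \<open>J\<close> of about \<open>n / 2\<close> vertices that contains all
  leaves, and remove the largest minimizer \<open>B\<close> of the submodular function
  \<open>|N(X) \<inter> K - X| - 2 |X|\<close>, where \<open>K\<close> is the complement of \<open>J\<close>. Then \<open>|B| < m\<close>, and every small set of
  the remaining vertices expands by a factor of two into \<open>K - B\<close>. The distribution of \<open>B\<close> is
  invariant under permutations of \<open>J\<close>, so a given set of \<open>r\<close> leaves lies inside \<open>B\<close> with probability
  at most \<open>16\<^bsup>-r\<^esup>\<close>. A union bound over the at most \<open>r 4\<^sup>r\<close> such sets shows that every star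
  keeps at least \<open>r - 1\<close> leaves outside \<open>B\<close>, up to an error \<open>r 4\<^bsup>-r\<^esup>\<close>, which vanishes because
  the minimum degree tends to infinity.

  The surviving leaves are paired up and linked one pair after another by vertex-disjoint paths of
  logarithmic length. To keep the remaining leaves from being isolated by the paths already built, an
  extendability invariant in the spirit of Friedman and Pippenger is maintained: binary trees are
  grown from both ends until their last levels have \<open>m\<close> vertices and hence are joined by an edge, and
  then everything but the resulting path is released again.
\<close>

section \<open>Disjoint paths in joined graphs\<close>

definition nbhd_in :: "'a set \<Rightarrow> ('a \<Rightarrow> 'a \<Rightarrow> bool) \<Rightarrow> 'a set \<Rightarrow> 'a set" where
  "nbhd_in W E U = {y \<in> W. \<exists>x\<in>U. E x y}"

text \<open>Such graphs are often called \<open>m\<close>-joined. The condition speaks of arbitrary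
  subsets of \<open>W\<close>, so it passes to smaller vertex sets with the same \<open>m\<close>;
  this permits deleting the exceptional set later.\<close>

locale joined_graph =
  fixes W :: "'a set" and E :: "'a \<Rightarrow> 'a \<Rightarrow> bool" and m :: nat
  assumes finite_W: "finite W"
    and E_sym: "E x y \<Longrightarrow> E y x"
    and m_pos: "0 < m"
    and joined: "\<lbrakk>X \<subseteq> W; Y \<subseteq> W; X \<inter> Y = {}; m \<le> card X; m \<le> card Y\<rbrakk> \<Longrightarrow> \<exists>x\<in>X. \<exists>y\<in>Y. E x y"
begin

abbreviation nbhd :: "'a set \<Rightarrow> 'a set" where
  "nbhd \<equiv> nbhd_in W E"

lemma nbhd_Un: "nbhd (A \<union> B) = nbhd A \<union> nbhd B"
  by (auto simp: nbhd_in_def)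

lemma nbhd_mono: "A \<subseteq> B \<Longrightarrow> nbhd A \<subseteq> nbhd B"
  by (auto simp: nbhd_in_def)

lemma nbhd_subset: "nbhd U \<subseteq> W"
  by (auto simp: nbhd_in_def)

lemma finite_nbhd [simp]: "finite (nbhd U)"
  using finite_W nbhd_subset by (rule rev_finite_subset)

lemma finite_subset_W: "U \<subseteq> W \<Longrightarrow> finite U"
  using finite_W by (rule rev_finite_subset)

lemma card_non_nbhd_less:
  assumes "U \<subseteq> W" "m \<le> card U"
  shows "card (W - U - nbhd U) < m"
proof (rule ccontr)
  assume "\<not> ?thesis"
  then have "\<exists>x\<in>U. \<exists>y\<in>W - U - nbhd U. E x y"
    using assms by (intro joined) auto
  then show False by (auto simp: nbhd_in_def)
qed

text \<open>\<open>F\<close> is the set of occupied vertices and \<open>c x\<close> the number of further children that a tree vertex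
  \<open>x\<close> may still receive, with \<open>c x = 2\<close> for free vertices. Moving a neighbour of \<open>s\<close> into \<open>F\<close> costs one
  unit of \<open>c s\<close>, and releasing that neighbour gives the unit back.\<close>
definition extendable :: "'a set \<Rightarrow> ('a \<Rightarrow> nat) \<Rightarrow> bool" where
  "extendable F c \<longleftrightarrow> (\<forall>U\<subseteq>W. card U \<le> 2 * m \<longrightarrow> sum c U \<le> card (nbhd U - F))"

section \<open>Tight sets and the addition of a single vertex\<close>

lemma extendableD: "extendable F c \<Longrightarrow> U \<subseteq> W \<Longrightarrow> card U \<le> 2 * m \<Longrightarrow> sum c U \<le> card (nbhd U - F)"
  by (auto simp: extendable_def)

text \<open>If \<open>U\<close> had \<open>m\<close> or more vertices, joinedness would leave fewer
  than \<open>m\<close> vertices outside \<open>U\<close> and its neighbourhood. Then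
  \<open>W\<close> would be covered by these, \<open>U\<close>, \<open>F\<close> and the free
  neighbourhood, fewer than \<open>m + 2 * m + card F + 4 * m\<close> vertices in all. This is the
  source of the constant 7.\<close>

lemma tight_card_less:
  assumes c: "\<And>x. c x \<le> 2" and F: "F \<subseteq> W" "card F + 7 * m \<le> card W"
    and U: "U \<subseteq> W" "card U \<le> 2 * m" "card (nbhd U - F) \<le> sum c U"
  shows "card U < m"
proof (rule ccontr)
  assume "\<not> card U < m"
  then have 1: "card (W - U - nbhd U) < m" using U by (intro card_non_nbhd_less) auto
  have fin: "finite F" "finite U" using F U finite_subset_W by auto
  have "W \<subseteq> (W - U - nbhd U) \<union> U \<union> F \<union> (nbhd U - F)" by auto
  then have "card W \<le> card ((W - U - nbhd U) \<union> U \<union> F \<union> (nbhd U - F))"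
    using finite_W fin by (intro card_mono) auto
  also have "\<dots> \<le> card (W - U - nbhd U) + card U + card F + card (nbhd U - F)"
    by (meson card_Un_le add_mono le_refl order_trans)
  finally have "card W < m + card U + card F + card (nbhd U - F)" using 1 by simp
  moreover have "sum c U \<le> 2 * card U" using sum_bounded_above[of U c 2] c by simp
  ultimately show False using U F by linarith
qed

text \<open>The difference \<open>card (nbhd U - F) - sum c U\<close> is submodular and, by
  extendability, nonnegative on the intersection, so it is at most zero on the union. Two sets below
  \<open>m\<close> have a union of at most \<open>2 * m\<close> vertices, which is why extendability
  is required up to that size; \<open>small\<close> brings the union back below
  \<open>m\<close>.\<close>

lemma tight_Un:
  assumes ext: "extendable F c" and U: "U \<subseteq> W" "card U < m" "card (nbhd U - F) \<le> sum c U"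
    and U': "U' \<subseteq> W" "card U' < m" "card (nbhd U' - F) \<le> sum c U'"
    and small: "\<And>X. X \<subseteq> W \<Longrightarrow> card X \<le> 2 * m \<Longrightarrow> card (nbhd X - F) \<le> sum c X \<Longrightarrow> card X < m"
  shows "card (U \<union> U') < m \<and> card (nbhd (U \<union> U') - F) \<le> sum c (U \<union> U')"
proof -
  have fin: "finite U" "finite U'" using U U' finite_subset_W by auto
  have c2: "card (U \<union> U') \<le> 2 * m" using card_Un_le[of U U'] U U' by linarith
  have "card (U \<inter> U') \<le> card U" using fin by (intro card_mono) auto
  then have "sum c (U \<inter> U') \<le> card (nbhd (U \<inter> U') - F)"
    using U by (intro extendableD[OF ext]) auto
  also have "\<dots> \<le> card ((nbhd U - F) \<inter> (nbhd U' - F))"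
    by (intro card_mono finite_Int disjI1 finite_Diff finite_nbhd) (auto simp: nbhd_in_def)
  finally have 1: "sum c (U \<inter> U') \<le> card ((nbhd U - F) \<inter> (nbhd U' - F))" .
  have 2: "card (nbhd (U \<union> U') - F) = card ((nbhd U - F) \<union> (nbhd U' - F))"
    by (simp add: nbhd_Un Un_Diff)
  have 3: "card ((nbhd U - F) \<union> (nbhd U' - F)) + card ((nbhd U - F) \<inter> (nbhd U' - F))
     = card (nbhd U - F) + card (nbhd U' - F)"
    using card_Un_Int[of "nbhd U - F" "nbhd U' - F"] by simp
  have 4: "sum c (U \<union> U') + sum c (U \<inter> U') = sum c U + sum c U'"
    using sum.union_inter[OF fin, of c] .
  have 5: "card (nbhd (U \<union> U') - F) \<le> sum c (U \<union> U')"
    using 1 2 3 4 U U' by linarith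
  then show ?thesis using small[OF _ c2 5] U U' by auto
qed

text \<open>If no neighbour \<open>y\<close> of \<open>s\<close> could be added, each would be blocked by a tight set. By submodularity the
  union of these tight sets is tight, and adding \<open>s\<close> to it violates extendability.\<close>
lemma extend_vertex:
  assumes ext: "extendable F c" and c: "\<And>x. c x \<le> 2" and F: "F \<subseteq> W" "card F + 7 * m \<le> card W"
    and s: "s \<in> W" "0 < c s"
  obtains y where "y \<in> W - F" "E s y" "extendable (insert y F) (c(s := c s - 1))"
proof -
  define tight where "tight U \<longleftrightarrow> U \<subseteq> W \<and> card U < m \<and> card (nbhd U - F) \<le> sum c U" for U
  have small: "card X < m" if "X \<subseteq> W" "card X \<le> 2 * m" "card (nbhd X - F) \<le> sum c X" for X
    using tight_card_less[OF c F that] .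
  have "\<exists>y\<in>nbhd {s} - F. extendable (insert y F) (c(s := c s - 1))"
  proof (rule ccontr)
    assume *: "\<not> ?thesis"
    have "\<exists>U. tight U \<and> y \<in> nbhd U \<and> s \<notin> U" if y: "y \<in> nbhd {s} - F" for y
    proof -
      from * y obtain U where U: "U \<subseteq> W" "card U \<le> 2 * m"
        and less: "card (nbhd U - insert y F) < sum (c(s := c s - 1)) U"
        by (auto simp: extendable_def not_le)
      have fin: "finite U" using U finite_subset_W by auto
      have base: "sum c U \<le> card (nbhd U - F)" by (rule extendableD[OF ext U])
      have eq: "nbhd U - insert y F = (nbhd U - F) - {y}" by auto
      \<comment> \<open>Inside \<open>U\<close>, the vertex \<open>s\<close> would lower the demand
        by one, which already makes up for the loss of \<open>y\<close>, so the old inequality would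
        fail.\<close>
      have s_notin: "s \<notin> U"
      proof
        assume sU: "s \<in> U"
        have "sum (c(s := c s - 1)) U = (c s - 1) + sum c (U - {s})"
          using sU fin by (simp add: sum.remove[of U s])
        moreover have "sum c U = c s + sum c (U - {s})"
          using sU fin by (simp add: sum.remove[of U s])
        moreover have "card (nbhd U - F) - 1 \<le> card (nbhd U - F - {y})"
          by (simp add: card_Diff_singleton_if)
        ultimately show False using less[unfolded eq] base s by linarith
      qed
      then have sum_eq: "sum (c(s := c s - 1)) U = sum c U"
        by (intro sum.cong) auto
      have y_in: "y \<in> nbhd U"
      proof (rule ccontr)
        assume "y \<notin> nbhd U"
        then have "nbhd U - insert y F = nbhd U - F" by auto
        then show False using less base sum_eq by simp
      qed
      have "card (nbhd U - F) \<le> sum c U"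
        using less sum_eq y_in y by (simp add: eq card_Diff_singleton)
      then show ?thesis using small[of U] U s_notin y_in by (auto simp: tight_def)
    qed
    then obtain UU where UU: "\<And>y. y \<in> nbhd {s} - F \<Longrightarrow> tight (UU y) \<and> y \<in> nbhd (UU y) \<and> s \<notin> UU y"
      by metis
    \<comment> \<open>Starting from the empty set also covers the case where \<open>s\<close> has no
      free neighbour at all.\<close>
    have tight0: "tight {}" using m_pos by (auto simp: tight_def nbhd_in_def)
    have "tight (\<Union> (UU ` Y))" if "Y \<subseteq> nbhd {s} - F" for Y
    proof -
      have "finite Y" using that by (rule finite_subset) simp
      then show ?thesis using that
      proof induction
        case empty then show ?case using tight0 by simp
      next
        case (insert y Y)
        have "tight (UU y)" "tight (\<Union> (UU ` Y))" using insert UU by auto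
        then show ?case using tight_Un[OF ext, of "UU y" "\<Union> (UU ` Y)"] small
          by (simp add: tight_def)
      qed
    qed
    from this[of "nbhd {s} - F"] obtain U where U: "U = \<Union> (UU ` (nbhd {s} - F))" "tight U" by auto
    have fin: "finite U" using U finite_subset_W by (auto simp: tight_def)
    have sU: "s \<notin> U" using UU U by auto
    \<comment> \<open>\<open>s\<close> brings no free neighbour that \<open>U\<close> does not have,
      while its demand \<open>c s\<close> is positive.\<close>
    have sub: "nbhd {s} - F \<subseteq> nbhd U" using UU U(1) nbhd_mono[of "UU _" U] by blast
    have "sum c (insert s U) \<le> card (nbhd (insert s U) - F)"
      using U(2) s sU fin m_pos by (intro extendableD[OF ext]) (auto simp: tight_def)
    also have "nbhd (insert s U) - F = nbhd U - F"
      using sub nbhd_Un[of "{s}" U] by auto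
    also have "card \<dots> \<le> sum c U" using U by (simp add: tight_def)
    finally show False using s sU fin by simp
  qed
  then show thesis using that by (auto simp: nbhd_in_def)
qed

section \<open>Growing binary trees\<close>

lemma extend_level:
  assumes "finite L" and "extendable F c" and "\<And>x. c x \<le> 2" and "L \<subseteq> F" "F \<subseteq> W"
    and "\<And>x. x \<in> L \<Longrightarrow> c x = 2" and "card F + 2 * card L + 7 * m \<le> card W"
  shows "\<exists>L' \<pi>. L' \<subseteq> W - F \<and> card L' = 2 * card L \<and> (\<forall>y\<in>L'. \<pi> y \<in> L \<and> E (\<pi> y) y) \<and>
    (\<forall>x\<in>L. card {y\<in>L'. \<pi> y = x} = 2) \<and> extendable (F \<union> L') (\<lambda>x. if x \<in> L then 0 else c x)"
  using assms
proof (induction L rule: finite_induct)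
  case empty
  then show ?case by (intro exI[of _ "{}"]) auto
next
  case (insert x L)
  then obtain L' \<pi> where L': "L' \<subseteq> W - F" "card L' = 2 * card L" "\<forall>y\<in>L'. \<pi> y \<in> L \<and> E (\<pi> y) y"
    "\<forall>x\<in>L. card {y\<in>L'. \<pi> y = x} = 2" and ext: "extendable (F \<union> L') (\<lambda>x. if x \<in> L then 0 else c x)"
    by auto
  let ?c = "\<lambda>x. if x \<in> L then 0 else c x"
  have fin: "finite L'" "finite F"
    using L'(1) insert.prems(4) finite_subset_W[of L'] finite_subset_W[of F] by auto
  have card1: "card (F \<union> L') = card F + 2 * card L"
    using L' fin by (subst card_Un_disjoint) auto
  have cx: "?c x = 2" using insert by auto
  obtain y1 where y1: "y1 \<in> W - (F \<union> L')" "E x y1" and ext1: "extendable (insert y1 (F \<union> L')) (?c(x := ?c x - 1))"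
  proof (rule extend_vertex[OF ext])
    show "(if z \<in> L then 0 else c z) \<le> 2" for z using insert.prems(2) by simp
  qed (use insert L' card1 in auto)
  let ?F1 = "insert y1 (F \<union> L')" and ?c1 = "?c(x := ?c x - 1)"
  have card2: "card ?F1 = card F + 2 * card L + 1"
    using y1 fin card1 by simp
  obtain y2 where y2: "y2 \<in> W - ?F1" "E x y2" and ext2: "extendable (insert y2 ?F1) (?c1(x := ?c1 x - 1))"
  proof (rule extend_vertex[OF ext1])
    show "?c1 z \<le> 2" for z using insert.prems(2)[of z] cx by simp
    show "card ?F1 + 7 * m \<le> card W" using card2 insert by simp
    show "0 < ?c1 x" using cx by simp
  qed (use insert L' card1 y1 in auto)
  define L2 where "L2 = insert y2 (insert y1 L')"
  define \<pi>2 where "\<pi>2 y = (if y = y1 \<or> y = y2 then x else \<pi> y)" for y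
  have ne: "y1 \<noteq> y2" "y1 \<notin> L'" "y2 \<notin> L'" using y1 y2 by auto
  have "{y \<in> L2. \<pi>2 y = x} = {y1, y2}" using L' insert(2) ne by (auto simp: L2_def \<pi>2_def)
  then have cx2: "card {y \<in> L2. \<pi>2 y = x} = 2" using ne by simp
  have cL: "{y \<in> L2. \<pi>2 y = z} = {y \<in> L'. \<pi> y = z}" if "z \<in> L" for z
    using ne insert(2) that by (auto simp: L2_def \<pi>2_def)
  have ceq: "?c1(x := ?c1 x - 1) = (\<lambda>z. if z \<in> insert x L then 0 else c z)"
    using cx by (auto simp: fun_eq_iff)
  have Feq: "insert y2 ?F1 = F \<union> L2" by (auto simp: L2_def)
  show ?case
  proof (intro exI[of _ L2] exI[of _ \<pi>2] conjI)
    show "extendable (F \<union> L2) (\<lambda>z. if z \<in> insert x L then 0 else c z)"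
      using ext2 by (simp only: ceq Feq)
    show "card L2 = 2 * card (insert x L)" using ne fin L' insert by (simp add: L2_def)
    show "\<forall>x\<in>insert x L. card {y \<in> L2. \<pi>2 y = x} = 2" using cx2 cL L' by auto
    show "\<forall>y\<in>L2. \<pi>2 y \<in> insert x L \<and> E (\<pi>2 y) y" using L' y1 y2 by (auto simp: L2_def \<pi>2_def)
    show "L2 \<subseteq> W - F" using L' y1 y2 by (auto simp: L2_def)
  qed
qed

definition tree_path :: "('a \<Rightarrow> 'a) \<Rightarrow> 'a list \<Rightarrow> bool" where
  "tree_path \<pi> = successively (\<lambda>x y. \<pi> y = x)"

text \<open>The last level is doubled \<open>k\<close> times; below the root this makes 2 + 4 + ...
  + \<open>2 ^ k\<close> vertices, hence the bound on \<open>card T\<close>. The inequality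
  \<open>c x \<le> c' x + card {y\<in>T. \<pi> y = x}\<close> records that every lost unit of demand
  was spent on a child in \<open>T\<close>, which is what a later release relies on.\<close>

lemma extend_tree:
  assumes "extendable F c" and "\<And>x. c x \<le> 2" and "a \<in> F" "F \<subseteq> W" "c a = 2"
    and "\<And>x. x \<in> W - F \<Longrightarrow> c x = 2" and "card F + 2 ^ (k + 1) + 7 * m \<le> card W"
  shows "\<exists>T L \<pi> c'. T \<subseteq> W - F \<and> L \<subseteq> insert a T \<and> card L = 2 ^ k \<and> card T + 2 \<le> 2 ^ (k + 1) \<and>
    (\<forall>y\<in>T. E (\<pi> y) y) \<and> (\<forall>x. c' x \<le> 2) \<and> (\<forall>x\<in>L. c' x = 2) \<and>
    (\<forall>x. x \<notin> insert a T \<longrightarrow> c' x = c x) \<and> (\<forall>x. c x \<le> c' x + card {y\<in>T. \<pi> y = x}) \<and>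
    extendable (F \<union> T) c' \<and>
    (\<forall>y\<in>L. \<exists>p. length p = k + 1 \<and> hd p = a \<and> last p = y \<and> distinct p \<and> set p \<subseteq> insert a T \<and>
       tree_path \<pi> p)"
  using assms(7)
proof (induction k)
  case 0
  show ?case using assms
    by (intro exI[of _ "{}"] exI[of _ "{a}"] exI[of _ id] exI[of _ c]) (auto simp: tree_path_def intro!: exI[of _ "[a]"])
next
  case (Suc k)
  have "card F + 2 ^ (k + 1) + 7 * m \<le> card W" using Suc.prems by simp
  from Suc.IH[OF this] obtain T L \<pi> c' where T: "T \<subseteq> W - F" "L \<subseteq> insert a T" "card L = 2 ^ k"
    "card T + 2 \<le> 2 ^ (k + 1)" "\<forall>y\<in>T. E (\<pi> y) y" and c': "\<forall>x. c' x \<le> 2" "\<forall>x\<in>L. c' x = 2"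
    "\<forall>x. x \<notin> insert a T \<longrightarrow> c' x = c x" "\<forall>x. c x \<le> c' x + card {y\<in>T. \<pi> y = x}"
    and ext: "extendable (F \<union> T) c'"
    and paths: "\<forall>y\<in>L. \<exists>p. length p = k + 1 \<and> hd p = a \<and> last p = y \<and> distinct p \<and>
      set p \<subseteq> insert a T \<and> tree_path \<pi> p" by blast
  have fin: "finite F" "finite T"
    using finite_subset_W[OF assms(4)] finite_subset_W[of T] T(1) by auto
  have cFT: "card (F \<union> T) = card F + card T" using fin T by (intro card_Un_disjoint) auto
  have "\<exists>L' \<pi>'. L' \<subseteq> W - (F \<union> T) \<and> card L' = 2 * card L \<and> (\<forall>y\<in>L'. \<pi>' y \<in> L \<and> E (\<pi>' y) y) \<and>
    (\<forall>x\<in>L. card {y\<in>L'. \<pi>' y = x} = 2) \<and> extendable ((F \<union> T) \<union> L') (\<lambda>x. if x \<in> L then 0 else c' x)"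
  proof (rule extend_level[OF _ ext])
    show "finite L" using T fin finite_subset by blast
    show "card (F \<union> T) + 2 * card L + 7 * m \<le> card W" using Suc.prems cFT T by simp
  qed (use c' T assms in auto)
  then obtain L' \<pi>' where L': "L' \<subseteq> W - (F \<union> T)" "card L' = 2 * card L"
    "\<forall>y\<in>L'. \<pi>' y \<in> L \<and> E (\<pi>' y) y" "\<forall>x\<in>L. card {y\<in>L'. \<pi>' y = x} = 2"
    and ext': "extendable ((F \<union> T) \<union> L') (\<lambda>x. if x \<in> L then 0 else c' x)" by blast
  have finL': "finite L'" using L' finite_subset_W[of L'] by auto
  define \<pi>2 where "\<pi>2 y = (if y \<in> L' then \<pi>' y else \<pi> y)" for y
  have disj: "L' \<inter> insert a T = {}" using L' assms(3) by auto
  have c2: "c x \<le> (if x \<in> L then 0 else c' x) + card {y\<in>T \<union> L'. \<pi>2 y = x}" for x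
  proof (cases "x \<in> L")
    case True
    have "card {y\<in>L'. \<pi>' y = x} \<le> card {y\<in>T \<union> L'. \<pi>2 y = x}"
      using fin finL' by (intro card_mono) (auto simp: \<pi>2_def)
    then show ?thesis using True L' assms(2)[of x] by simp
  next
    case False
    have "card {y\<in>T. \<pi> y = x} \<le> card {y\<in>T \<union> L'. \<pi>2 y = x}"
      using fin finL' disj by (intro card_mono) (auto simp: \<pi>2_def)
    moreover have "c x \<le> c' x + card {y\<in>T. \<pi> y = x}" using c'(4) by blast
    ultimately show ?thesis using False by simp
  qed
  have cL': "(if x \<in> L then 0 else c' x) = 2" if "x \<in> L'" for x
  proof -
    have "x \<in> W - F" "x \<notin> insert a T" "x \<notin> L" using disj T L' that by auto
    then show ?thesis using c'(3) assms(6) by simp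
  qed
  have paths': "\<exists>p. length p = Suc k + 1 \<and> hd p = a \<and> last p = y \<and> distinct p \<and>
      set p \<subseteq> insert a (T \<union> L') \<and> tree_path \<pi>2 p" if y: "y \<in> L'" for y
  proof -
    have "\<pi>' y \<in> L" using L' y by auto
    then obtain p where p: "length p = k + 1" "hd p = a" "last p = \<pi>' y" "distinct p"
      "set p \<subseteq> insert a T" "tree_path \<pi> p" using paths by blast
    have "p \<noteq> []" using p by auto
    moreover have "tree_path \<pi>2 p"
      using p(6) unfolding tree_path_def
      by (rule successively_mono) (use disj p(5) in \<open>auto simp: \<pi>2_def\<close>)
    ultimately show ?thesis using p y disj
      by (intro exI[of _ "p @ [y]"]) (auto simp: tree_path_def successively_append_iff \<pi>2_def)
  qed
  show ?case
  proof (rule exI[of _ "T \<union> L'"], rule exI[of _ L'], rule exI[of _ \<pi>2],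
      rule exI[of _ "\<lambda>x. if x \<in> L then 0 else c' x"], intro conjI)
    show "card (T \<union> L') + 2 \<le> 2 ^ (Suc k + 1)"
      using card_Un_le[of T L'] L' T by simp
    show "extendable (F \<union> (T \<union> L')) (\<lambda>x. if x \<in> L then 0 else c' x)"
      using ext' by (simp add: Un_assoc)
    show "\<forall>x\<in>L'. (if x \<in> L then 0 else c' x) = 2" using cL' by blast
    show "\<forall>x. c x \<le> (if x \<in> L then 0 else c' x) + card {y \<in> T \<union> L'. \<pi>2 y = x}" using c2 by blast
    show "\<forall>y\<in>L'. \<exists>p. length p = Suc k + 1 \<and> hd p = a \<and> last p = y \<and> distinct p \<and>
      set p \<subseteq> insert a (T \<union> L') \<and> tree_path \<pi>2 p" using paths' by blast
    show "card L' = 2 ^ Suc k" using L' T by simp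
    show "\<forall>y\<in>T \<union> L'. E (\<pi>2 y) y" using T L' disj by (auto simp: \<pi>2_def)
  qed (use T L' c' in auto)
qed

section \<open>Releasing a tree except for one path\<close>

text \<open>Children of distinct parents are distinct, so the released vertices with parent in
  \<open>U\<close> are that many additional free neighbours of \<open>U\<close>, and they pay for
  the rise of the demand from \<open>c'\<close> to \<open>c\<close>.\<close>

lemma extendable_rollback:
  assumes ext: "extendable (F \<union> T) c'" and T: "T \<subseteq> W" "F \<inter> T = {}" "\<forall>y\<in>T. E (\<pi> y) y" "Q \<subseteq> T"
    and c: "\<And>x. x \<in> W \<Longrightarrow> c x \<le> c' x + card {y\<in>T - Q. \<pi> y = x}"
  shows "extendable (F \<union> Q) c"
  unfolding extendable_def
proof (intro allI impI)
  fix U assume U: "U \<subseteq> W" "card U \<le> 2 * m"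
  have fin: "finite U" "finite T" using U T finite_subset_W by auto
  have "sum c U \<le> (\<Sum>x\<in>U. c' x + card {y\<in>T - Q. \<pi> y = x})" using c U by (intro sum_mono) auto
  also have "\<dots> = sum c' U + (\<Sum>x\<in>U. card {y\<in>T - Q. \<pi> y = x})" by (simp add: sum.distrib)
  also have "(\<Sum>x\<in>U. card {y\<in>T - Q. \<pi> y = x}) = card (\<Union>x\<in>U. {y\<in>T - Q. \<pi> y = x})"
    using fin by (subst card_UN_disjoint) auto
  also have "sum c' U \<le> card (nbhd U - (F \<union> T))" using ext U by (rule extendableD)
  also have "card (nbhd U - (F \<union> T)) + card (\<Union>x\<in>U. {y\<in>T - Q. \<pi> y = x})
      = card ((nbhd U - (F \<union> T)) \<union> (\<Union>x\<in>U. {y\<in>T - Q. \<pi> y = x}))"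
    using fin by (subst card_Un_disjoint) auto
  also have "\<dots> \<le> card (nbhd U - (F \<union> Q))"
    using T by (intro card_mono finite_Diff finite_nbhd) (auto simp: nbhd_in_def)
  finally show "sum c U \<le> card (nbhd U - (F \<union> Q))" by simp
qed

lemma tree_path_parent:
  "tree_path \<pi> p \<Longrightarrow> y \<in> set p \<Longrightarrow> y \<noteq> hd p \<Longrightarrow> \<pi> y \<in> set p"
proof (induction p)
  case (Cons x p)
  then show ?case by (cases p) (auto simp: tree_path_def)
qed simp

lemma tree_path_rollback:
  assumes ext: "extendable (F \<union> T) c'" and T: "T \<subseteq> W" "F \<inter> T = {}" "\<forall>y\<in>T. E (\<pi> y) y"
    and p: "tree_path \<pi> p" "hd p = a" "p \<noteq> []" "set p \<subseteq> insert a T" "a \<in> F"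
    and c: "\<And>x. x \<in> W - set p \<Longrightarrow> c x \<le> c' x + card {y\<in>T. \<pi> y = x}"
    and c0: "\<And>x. x \<in> set p \<Longrightarrow> c x = 0"
  shows "extendable (F \<union> set p) c"
proof -
  have "extendable (F \<union> (set p - {a})) c"
  proof (rule extendable_rollback[OF ext T])
    show "set p - {a} \<subseteq> T" using p by auto
    fix x assume x: "x \<in> W"
    show "c x \<le> c' x + card {y \<in> T - (set p - {a}). \<pi> y = x}"
    proof (cases "x \<in> set p")
      case False
      \<comment> \<open>A vertex of \<open>p\<close> other than the root has its parent on
        \<open>p\<close>, so \<open>x\<close>, which lies off the path, has no child on it.\<close>
      then have "{y \<in> T - (set p - {a}). \<pi> y = x} = {y\<in>T. \<pi> y = x}"
        using tree_path_parent[OF p(1)] p(2) by auto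
      then show ?thesis using c[of x] x False by simp
    qed (simp add: c0)
  qed
  also have "F \<union> (set p - {a}) = F \<union> set p" using p by auto
  finally show ?thesis .
qed

lemma tree_path_walk:
  assumes "tree_path \<pi> p" "\<forall>y\<in>T. E (\<pi> y) y" "set p \<subseteq> insert a T" "hd p = a" "distinct p"
  shows "successively E p"
proof (cases p)
  case (Cons x q)
  \<comment> \<open>As \<open>p\<close> is distinct, the root does not recur, so every later vertex
    lies in \<open>T\<close> and its link to its parent is an edge.\<close>
  have "successively (\<lambda>x y. \<pi> y = x \<and> y \<in> T) p"
    unfolding Cons successively_conv_nth
    using assms by (auto simp: Cons tree_path_def successively_conv_nth dest!: nth_mem)
  then show ?thesis by (rule successively_mono) (use assms in auto)
qed simp

text \<open>In use, \<open>P\<close> consists of finished paths, whose vertices need no further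
  children; the rest of \<open>F\<close> are terminals still waiting, with full demand. Trees with
  \<open>2 ^ k \<ge> m\<close> leaves are grown from \<open>a\<close> and \<open>b\<close>, an edge
  joins their last levels, and everything but the two root-to-leaf paths is released.\<close>

lemma connect:
  assumes ext: "extendable F (\<lambda>x. if x \<in> P then 0 else 2)" and F: "F \<subseteq> W" "P \<subseteq> F"
    and ab: "a \<in> F - P" "b \<in> F - P" "a \<noteq> b"
    and k: "m \<le> 2 ^ k" "card F + 2 * 2 ^ (k + 1) + 7 * m \<le> card W"
  obtains p where "length p = 2 * (k + 1)" "hd p = a" "last p = b" "distinct p" "set p \<subseteq> W"
    "successively E p" "set p \<inter> F = {a, b}"
    "extendable (F \<union> set p) (\<lambda>x. if x \<in> P \<union> set p then 0 else 2)"
proof -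
  let ?c = "\<lambda>x. if x \<in> P then 0 else (2::nat)"
  have "\<exists>T L \<pi> c'. T \<subseteq> W - F \<and> L \<subseteq> insert a T \<and> card L = 2 ^ k \<and> card T + 2 \<le> 2 ^ (k + 1) \<and>
    (\<forall>y\<in>T. E (\<pi> y) y) \<and> (\<forall>x. c' x \<le> 2) \<and> (\<forall>x\<in>L. c' x = 2) \<and>
    (\<forall>x. x \<notin> insert a T \<longrightarrow> c' x = ?c x) \<and> (\<forall>x. ?c x \<le> c' x + card {y\<in>T. \<pi> y = x}) \<and>
    extendable (F \<union> T) c' \<and>
    (\<forall>y\<in>L. \<exists>p. length p = k + 1 \<and> hd p = a \<and> last p = y \<and> distinct p \<and> set p \<subseteq> insert a T \<and>
       tree_path \<pi> p)"
    by (rule extend_tree[OF ext]) (use ab F k in auto)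
  then obtain T1 L1 \<pi>1 c1 where T1: "T1 \<subseteq> W - F" "L1 \<subseteq> insert a T1" "card L1 = 2 ^ k"
    "card T1 + 2 \<le> 2 ^ (k + 1)" "\<forall>y\<in>T1. E (\<pi>1 y) y" and c1: "\<forall>x. c1 x \<le> 2"
    "\<forall>x. x \<notin> insert a T1 \<longrightarrow> c1 x = ?c x" "\<forall>x. ?c x \<le> c1 x + card {y\<in>T1. \<pi>1 y = x}"
    and ext1: "extendable (F \<union> T1) c1" and paths1: "\<forall>y\<in>L1. \<exists>p. length p = k + 1 \<and> hd p = a \<and>
      last p = y \<and> distinct p \<and> set p \<subseteq> insert a T1 \<and> tree_path \<pi>1 p"
    by blast
  have fin: "finite F" "finite T1"
    using finite_subset_W[OF F(1)] finite_subset_W[of T1] T1(1) by auto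
  have cF1: "card (F \<union> T1) = card F + card T1" using T1 fin by (intro card_Un_disjoint) auto
  have "\<exists>T L \<pi> c'. T \<subseteq> W - (F \<union> T1) \<and> L \<subseteq> insert b T \<and> card L = 2 ^ k \<and> card T + 2 \<le> 2 ^ (k + 1) \<and>
    (\<forall>y\<in>T. E (\<pi> y) y) \<and> (\<forall>x. c' x \<le> 2) \<and> (\<forall>x\<in>L. c' x = 2) \<and>
    (\<forall>x. x \<notin> insert b T \<longrightarrow> c' x = c1 x) \<and> (\<forall>x. c1 x \<le> c' x + card {y\<in>T. \<pi> y = x}) \<and>
    extendable ((F \<union> T1) \<union> T) c' \<and>
    (\<forall>y\<in>L. \<exists>p. length p = k + 1 \<and> hd p = b \<and> last p = y \<and> distinct p \<and> set p \<subseteq> insert b T \<and>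
       tree_path \<pi> p)"
  proof (rule extend_tree[OF ext1])
    show "c1 x \<le> 2" for x using c1 by blast
    have "b \<notin> insert a T1" "b \<notin> P" using ab T1 by auto
    then show "c1 b = 2" using c1 by simp
    show "c1 x = 2" if "x \<in> W - (F \<union> T1)" for x
    proof -
      have "x \<notin> insert a T1" "x \<notin> P" using that ab F by auto
      then show ?thesis using c1 by simp
    qed
  qed (use ab F k T1 cF1 in auto)
  then obtain T2 L2 \<pi>2 c2 where T2: "T2 \<subseteq> W - (F \<union> T1)" "L2 \<subseteq> insert b T2" "card L2 = 2 ^ k"
    "\<forall>y\<in>T2. E (\<pi>2 y) y" and c2: "\<forall>x. c1 x \<le> c2 x + card {y\<in>T2. \<pi>2 y = x}"
    and ext2: "extendable ((F \<union> T1) \<union> T2) c2" and paths2: "\<forall>y\<in>L2. \<exists>p. length p = k + 1 \<and> hd p = b \<and>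
      last p = y \<and> distinct p \<and> set p \<subseteq> insert b T2 \<and> tree_path \<pi>2 p"
    by blast
  have disj: "insert a T1 \<inter> insert b T2 = {}" using T1 T2 ab by auto
  have "\<exists>x\<in>L1. \<exists>y\<in>L2. E x y"
  proof (rule joined)
    show "L1 \<inter> L2 = {}" using T1(2) T2(2) disj by blast
  qed (use T1 T2 ab F k in auto)
  then obtain x y where xy: "x \<in> L1" "y \<in> L2" "E x y" by blast
  obtain p where p: "length p = k + 1" "hd p = a" "last p = x" "distinct p" "set p \<subseteq> insert a T1"
    "tree_path \<pi>1 p" using paths1 xy by blast
  obtain q where q: "length q = k + 1" "hd q = b" "last q = y" "distinct q" "set q \<subseteq> insert b T2"
    "tree_path \<pi>2 q" using paths2 xy by blast
  have ne: "p \<noteq> []" "q \<noteq> []" using p q by auto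
  have in_p: "a \<in> set p" "b \<in> set q" using ne p q hd_in_set by metis+
  \<comment> \<open>The second tree is released first: its rollback restores \<open>c1\<close>, the
    demand from which the rollback of the first tree starts.\<close>
  have "extendable ((F \<union> T1) \<union> set q) (\<lambda>x. if x \<in> set q then 0 else c1 x)"
    by (rule tree_path_rollback[OF ext2 _ _ T2(4) q(6,2) ne(2) q(5)]) (use T2 T1 ab c2 in auto)
  then have ext3: "extendable ((F \<union> set q) \<union> T1) (\<lambda>x. if x \<in> set q then 0 else c1 x)"
    by (simp add: Un_ac)
  have ext4: "extendable ((F \<union> set q) \<union> set p) (\<lambda>x. if x \<in> P \<union> (set p \<union> set q) then 0 else 2)"
    by (rule tree_path_rollback[OF ext3 _ _ T1(5) p(6,2) ne(1) p(5)])
       (use T1 T2 ab c1 q disj in \<open>auto split: if_splits\<close>)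
  show thesis
  proof (rule that[of "p @ rev q"])
    show "length (p @ rev q) = 2 * (k + 1)" using p q by simp
    show "hd (p @ rev q) = a" "last (p @ rev q) = b" using p q ne by (auto simp: last_rev)
    show "distinct (p @ rev q)" using p q disj by auto
    show "set (p @ rev q) \<subseteq> W" using p q T1 T2 ab F by auto
    show "set (p @ rev q) \<inter> F = {a, b}" using p q T1 T2 ab in_p by auto
    show "extendable (F \<union> set (p @ rev q)) (\<lambda>x. if x \<in> P \<union> set (p @ rev q) then 0 else 2)"
      using ext4 by (simp add: Un_ac)
    have "successively E (rev q)"
      unfolding successively_rev
      by (rule successively_mono[OF tree_path_walk[OF q(6) T2(4) q(5,2,4)]]) (rule E_sym)
    moreover have "successively E p" by (rule tree_path_walk[OF p(6) T1(5) p(5,2,4)])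
    ultimately show "successively E (p @ rev q)"
      using ne p q xy by (simp add: successively_append_iff hd_rev)
  qed
qed

text \<open>A path has \<open>2 * (k + 1)\<close> vertices, two of them terminals already in
  \<open>F\<close>, so each path costs \<open>2 * k\<close> new vertices.\<close>

theorem route_pairs:
  assumes "finite I" and F: "F \<subseteq> W" "extendable F (\<lambda>_. 2)"
    and "a ` I \<subseteq> F" "b ` I \<subseteq> F" "inj_on a I" "inj_on b I" "a ` I \<inter> b ` I = {}"
    and k: "m \<le> 2 ^ k" "card F + card I * (2 * k) + 2 * 2 ^ (k + 1) + 7 * m \<le> card W"
  shows "\<exists>p. (\<forall>i\<in>I. p i \<noteq> [] \<and> hd (p i) = a i \<and> last (p i) = b i \<and> distinct (p i) \<and> set (p i) \<subseteq> W \<and>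
      successively E (p i)) \<and> disjoint_family_on (\<lambda>i. set (p i)) I"
proof -
  \<comment> \<open>The induction also carries that a path meets \<open>F\<close> only in its own
    two ends; the terminals of later pairs thus stay off all earlier paths.\<close>
  have "\<exists>p. (\<forall>i\<in>I. length (p i) = 2 * (k + 1) \<and> hd (p i) = a i \<and> last (p i) = b i \<and> distinct (p i) \<and>
      set (p i) \<subseteq> W \<and> successively E (p i) \<and> set (p i) \<inter> F = {a i, b i}) \<and> disjoint_family_on (\<lambda>i. set (p i)) I \<and>
      extendable (F \<union> (\<Union>i\<in>I. set (p i))) (\<lambda>x. if x \<in> (\<Union>i\<in>I. set (p i)) then 0 else 2) \<and>
      card (F \<union> (\<Union>i\<in>I. set (p i))) \<le> card F + card I * (2 * k)"
    using assms
  proof (induction I rule: finite_induct)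
    case empty
    then show ?case by (auto simp: disjoint_family_on_def)
  next
    case (insert j I)
    then obtain p where p: "\<forall>i\<in>I. length (p i) = 2 * (k + 1) \<and> hd (p i) = a i \<and> last (p i) = b i \<and> distinct (p i) \<and>
      set (p i) \<subseteq> W \<and> successively E (p i) \<and> set (p i) \<inter> F = {a i, b i}" "disjoint_family_on (\<lambda>i. set (p i)) I"
      and ext: "extendable (F \<union> (\<Union>i\<in>I. set (p i))) (\<lambda>x. if x \<in> (\<Union>i\<in>I. set (p i)) then 0 else 2)"
      and card: "card (F \<union> (\<Union>i\<in>I. set (p i))) \<le> card F + card I * (2 * k)"
      by (auto simp: algebra_simps)
    let ?P = "\<Union>i\<in>I. set (p i)"
    have fin: "finite (F \<union> ?P)" using insert(1) finite_subset_W[OF insert.prems(1)] by auto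
    have PF: "?P \<inter> F = a ` I \<union> b ` I" using p(1) by blast
    have new: "a j \<in> F - ?P" "b j \<in> F - ?P" "a j \<noteq> b j"
      using PF insert.prems insert(2) by (auto simp: inj_on_def)
    obtain q where q: "length q = 2 * (k + 1)" "hd q = a j" "last q = b j" "distinct q" "set q \<subseteq> W"
      "successively E q" "set q \<inter> (F \<union> ?P) = {a j, b j}"
      and extq: "extendable ((F \<union> ?P) \<union> set q) (\<lambda>x. if x \<in> ?P \<union> set q then 0 else 2)"
    proof (rule connect[OF ext])
      show "card (F \<union> ?P) + 2 * 2 ^ (k + 1) + 7 * m \<le> card W"
        using card insert by (simp add: algebra_simps)
    qed (use new insert p in auto)
    let ?p = "p(j := q)"
    have U: "(\<Union>i\<in>insert j I. set (?p i)) = ?P \<union> set q"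
      using insert(2) by (auto split: if_splits)
    have "set q \<inter> ?P \<subseteq> {a j, b j}" unfolding q(7)[symmetric] by (intro Int_mono order_refl Un_upper2)
    moreover have "a j \<notin> ?P" "b j \<notin> ?P" using new by auto
    ultimately have qP: "set q \<inter> ?P = {}" by blast
    have "card ((F \<union> ?P) \<union> set q) + card ((F \<union> ?P) \<inter> set q) = card (F \<union> ?P) + card (set q)"
      using card_Un_Int[OF fin, of "set q"] by simp
    moreover have "(F \<union> ?P) \<inter> set q = {a j, b j}" using q(7) by (simp only: Int_commute)
    then have "card ((F \<union> ?P) \<inter> set q) = 2" using new(3) by simp
    moreover have "card (set q) = 2 * (k + 1)" using q distinct_card by metis
    ultimately have cq: "card ((F \<union> ?P) \<union> set q) = card (F \<union> ?P) + 2 * k" by simp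
    show ?case
    proof (intro exI[of _ ?p] conjI)
      show "disjoint_family_on (\<lambda>i. set (?p i)) (insert j I)"
        using p(2) qP insert(2) unfolding disjoint_family_on_def by auto
      show "extendable (F \<union> (\<Union>i\<in>insert j I. set (?p i))) (\<lambda>x. if x \<in> (\<Union>i\<in>insert j I. set (?p i)) then 0 else 2)"
        unfolding U using extq by (simp add: Un_ac)
      show "card (F \<union> (\<Union>i\<in>insert j I. set (?p i))) \<le> card F + card (insert j I) * (2 * k)"
        unfolding U using cq card insert(1,2) by (simp add: Un_ac)
      show "\<forall>i\<in>insert j I. length (?p i) = 2 * (k + 1) \<and> hd (?p i) = a i \<and> last (?p i) = b i \<and> distinct (?p i) \<and>
      set (?p i) \<subseteq> W \<and> successively E (?p i) \<and> set (?p i) \<inter> F = {a i, b i}"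
        using p(1) q new by auto
    qed
  qed
  then obtain p where p: "\<forall>i\<in>I. length (p i) = 2 * (k + 1) \<and> hd (p i) = a i \<and> last (p i) = b i \<and>
      distinct (p i) \<and> set (p i) \<subseteq> W \<and> successively E (p i) \<and> set (p i) \<inter> F = {a i, b i}"
    and disj: "disjoint_family_on (\<lambda>i. set (p i)) I" by blast
  have "p i \<noteq> []" if "i \<in> I" for i using p that by force
  then show ?thesis using p disj by blast
qed

end

section \<open>A small exceptional set\<close>

text \<open>Only neighbours in \<open>K\<close> count, so terminals placed outside \<open>K\<close>
  cannot use up the expansion. The value is an integer because poorly expanding sets have negative
  excess.\<close>

definition expansion_excess :: "'a set \<Rightarrow> ('a \<Rightarrow> 'a \<Rightarrow> bool) \<Rightarrow> 'a set \<Rightarrow> 'a set \<Rightarrow> int" where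
  "expansion_excess W E K X = int (card (nbhd_in W E X \<inter> K - X)) - 2 * int (card X)"

definition least_expanding :: "'a set \<Rightarrow> ('a \<Rightarrow> 'a \<Rightarrow> bool) \<Rightarrow> nat \<Rightarrow> 'a set \<Rightarrow> 'a set \<Rightarrow> bool" where
  "least_expanding W E m K X \<longleftrightarrow> X \<subseteq> W \<and> card X \<le> 2 * m \<and>
     (\<forall>Y\<subseteq>W. card Y \<le> 2 * m \<longrightarrow> expansion_excess W E K X \<le> expansion_excess W E K Y)"

text \<open>Taking the union of all minimizers makes the exceptional set equivariant under relabelling,
  which is what allows its distribution to be computed by symmetry.\<close>
definition bad_set :: "'a set \<Rightarrow> ('a \<Rightarrow> 'a \<Rightarrow> bool) \<Rightarrow> nat \<Rightarrow> 'a set \<Rightarrow> 'a set" where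
  "bad_set W E m K = \<Union> {X. least_expanding W E m K X}"

lemma bad_set_subset: "bad_set W E m K \<subseteq> W"
  by (auto simp: bad_set_def least_expanding_def)

section \<open>Equivariance of the exceptional set under relabelling\<close>

context
  fixes \<sigma> :: "'a \<Rightarrow> 'a" and W K :: "'a set" and E :: "'a \<Rightarrow> 'a \<Rightarrow> bool"
  assumes \<sigma>: "\<sigma> permutes W" and K: "\<sigma> ` K = K"
begin

lemma expansion_excess_relabel:
  "expansion_excess W (\<lambda>x y. E (\<sigma> x) (\<sigma> y)) K X = expansion_excess W E K (\<sigma> ` X)"
proof -
  have inj: "inj \<sigma>" using \<sigma> by (rule permutes_inj)
  have "\<sigma> ` nbhd_in W (\<lambda>x y. E (\<sigma> x) (\<sigma> y)) X = nbhd_in W E (\<sigma> ` X)"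
  proof
    show "nbhd_in W E (\<sigma> ` X) \<subseteq> \<sigma> ` nbhd_in W (\<lambda>x y. E (\<sigma> x) (\<sigma> y)) X"
    proof
      fix y assume y: "y \<in> nbhd_in W E (\<sigma> ` X)"
      then obtain z where "z \<in> W" "y = \<sigma> z"
        using permutes_image[OF \<sigma>] by (auto simp: nbhd_in_def)
      then show "y \<in> \<sigma> ` nbhd_in W (\<lambda>x y. E (\<sigma> x) (\<sigma> y)) X"
        using y by (auto simp: nbhd_in_def)
    qed
  qed (auto simp: nbhd_in_def permutes_in_image[OF \<sigma>])
  then have "\<sigma> ` (nbhd_in W (\<lambda>x y. E (\<sigma> x) (\<sigma> y)) X \<inter> K - X) = nbhd_in W E (\<sigma> ` X) \<inter> K - \<sigma> ` X"
    using inj K by (simp add: image_set_diff image_Int)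
  then have "card (nbhd_in W (\<lambda>x y. E (\<sigma> x) (\<sigma> y)) X \<inter> K - X) = card (nbhd_in W E (\<sigma> ` X) \<inter> K - \<sigma> ` X)"
    using card_image[OF inj_on_subset[OF inj subset_UNIV]] by metis
  moreover have "card (\<sigma> ` X) = card X"
    by (intro card_image inj_on_subset[OF inj subset_UNIV])
  ultimately show ?thesis by (simp add: expansion_excess_def)
qed

lemma least_expanding_relabel:
  "least_expanding W (\<lambda>x y. E (\<sigma> x) (\<sigma> y)) m K X \<longleftrightarrow> least_expanding W E m K (\<sigma> ` X)"
proof -
  have inj: "inj \<sigma>" using \<sigma> by (rule permutes_inj)
  have card: "card (\<sigma> ` Y) = card Y" for Y
    by (intro card_image inj_on_subset[OF inj subset_UNIV])
  have sub: "\<sigma> ` Y \<subseteq> W \<longleftrightarrow> Y \<subseteq> W" for Y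
    using permutes_in_image[OF \<sigma>] by auto
  \<comment> \<open>As \<open>\<sigma>\<close> permutes \<open>W\<close>, the images of subsets of
    \<open>W\<close> run through all subsets of \<open>W\<close>.\<close>
  have all: "(\<forall>Y\<subseteq>W. P Y) \<longleftrightarrow> (\<forall>Y\<subseteq>W. P (\<sigma> ` Y))" for P
    using all_subset_image[of \<sigma> W P] by (simp add: permutes_image[OF \<sigma>])
  show ?thesis
    unfolding least_expanding_def expansion_excess_relabel card sub
    by (subst (2) all) (simp add: card)
qed

lemma bad_set_relabel:
  "T \<subseteq> bad_set W (\<lambda>x y. E (\<sigma> x) (\<sigma> y)) m K \<longleftrightarrow> \<sigma> ` T \<subseteq> bad_set W E m K"
  "card (bad_set W (\<lambda>x y. E (\<sigma> x) (\<sigma> y)) m K) = card (bad_set W E m K)"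
proof -
  have inj: "inj \<sigma>" and bij: "bij \<sigma>" using \<sigma> by (auto intro: permutes_inj permutes_bij)
  have eq: "\<sigma> ` bad_set W (\<lambda>x y. E (\<sigma> x) (\<sigma> y)) m K = bad_set W E m K"
  proof -
    have "\<sigma> ` bad_set W (\<lambda>x y. E (\<sigma> x) (\<sigma> y)) m K
        = \<Union> ((`) \<sigma> ` {X. least_expanding W E m K (\<sigma> ` X)})"
      by (simp add: bad_set_def least_expanding_relabel image_Union)
    also have "(`) \<sigma> ` {X. least_expanding W E m K (\<sigma> ` X)} = {X. least_expanding W E m K X}"
    proof -
      have "X \<in> (`) \<sigma> ` {X. least_expanding W E m K (\<sigma> ` X)}" if "least_expanding W E m K X" for X
      proof -
        have "X = \<sigma> ` (inv \<sigma> ` X)" using bij by (simp add: image_f_inv_f bij_is_surj)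
        then show ?thesis using that by (metis (mono_tags) image_eqI mem_Collect_eq)
      qed
      then show ?thesis by auto
    qed
    finally show ?thesis by (simp add: bad_set_def)
  qed
  show "T \<subseteq> bad_set W (\<lambda>x y. E (\<sigma> x) (\<sigma> y)) m K \<longleftrightarrow> \<sigma> ` T \<subseteq> bad_set W E m K"
    unfolding eq[symmetric] using inj by (simp add: inj_image_subset_iff)
  show "card (bad_set W (\<lambda>x y. E (\<sigma> x) (\<sigma> y)) m K) = card (bad_set W E m K)"
    unfolding eq[symmetric] by (intro card_image[symmetric] inj_on_subset[OF inj subset_UNIV])
qed

end

section \<open>Minimizing a submodular function\<close>

context joined_graph
begin

text \<open>Adding \<open>Z \<inter> K\<close> back turns the outer neighbourhood into the closed
  one, \<open>A Z\<close>, whose size is a coverage function and hence submodular; the correction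
  terms \<open>card (Z \<inter> K)\<close> and \<open>2 * card Z\<close> are modular.\<close>

lemma expansion_excess_submodular:
  assumes "X \<subseteq> W" "Y \<subseteq> W" "K \<subseteq> W"
  shows "expansion_excess W E K (X \<union> Y) + expansion_excess W E K (X \<inter> Y)
    \<le> expansion_excess W E K X + expansion_excess W E K Y"
proof -
  define A where "A X = (nbhd X \<union> X) \<inter> K" for X
  have fin: "finite X" "finite Y" "finite K" using assms finite_subset_W by auto
  have finA: "finite (A Z)" for Z using fin by (simp add: A_def)
  have excess: "expansion_excess W E K Z = int (card (A Z)) - int (card (Z \<inter> K)) - 2 * int (card Z)" for Z
  proof -
    have "A Z = (nbhd Z \<inter> K - Z) \<union> Z \<inter> K" by (auto simp: A_def)
    moreover have "card ((nbhd Z \<inter> K - Z) \<union> Z \<inter> K) = card (nbhd Z \<inter> K - Z) + card (Z \<inter> K)"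
      using fin by (intro card_Un_disjoint) auto
    ultimately have "card (A Z) = card (nbhd Z \<inter> K - Z) + card (Z \<inter> K)" by simp
    then show ?thesis by (simp add: expansion_excess_def)
  qed
  have "card (A (X \<union> Y)) + card (A (X \<inter> Y)) \<le> card (A X \<union> A Y) + card (A X \<inter> A Y)"
    using finA by (intro add_mono card_mono finite_UnI finite_Int disjI1) (auto simp: A_def nbhd_in_def)
  also have "\<dots> = card (A X) + card (A Y)"
    using finA card_Un_Int by metis
  finally have 1: "card (A (X \<union> Y)) + card (A (X \<inter> Y)) \<le> card (A X) + card (A Y)" .
  have 2: "card ((X \<union> Y) \<inter> K) + card ((X \<inter> Y) \<inter> K) = card (X \<inter> K) + card (Y \<inter> K)"
    using card_Un_Int[of "X \<inter> K" "Y \<inter> K"] fin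
    by (simp add: Int_Un_distrib2 Int_Un_distrib Int_ac)
  have 3: "card (X \<union> Y) + card (X \<inter> Y) = card X + card Y"
    using card_Un_Int fin by metis
  show ?thesis unfolding excess using 1 2 3 by linarith
qed

lemma expansion_excess_empty: "expansion_excess W E K {} = 0"
  by (simp add: expansion_excess_def nbhd_in_def)

text \<open>By joinedness fewer than \<open>m\<close> vertices lie outside \<open>X\<close> and its
  neighbourhood. More than \<open>10 * m - m - card X\<close> vertices of \<open>K\<close> are thus
  outer neighbours, and this is at least \<open>2 * card X\<close> because
  \<open>3 * card X \<le> 9 * m\<close>.\<close>

lemma expansion_excess_pos:
  assumes K: "K \<subseteq> W" "10 * m \<le> card K" and X: "X \<subseteq> W" "m \<le> card X" "card X \<le> 3 * m"
  shows "0 < expansion_excess W E K X"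
proof -
  have fin: "finite X" "finite K" using X K finite_subset_W by auto
  have "card K \<le> card ((nbhd X \<inter> K - X) \<union> X \<union> (W - X - nbhd X))"
    using K fin finite_W by (intro card_mono) auto
  also have "\<dots> \<le> card (nbhd X \<inter> K - X) + card X + card (W - X - nbhd X)"
    by (meson card_Un_le add_mono le_refl order_trans)
  finally have "card K < card (nbhd X \<inter> K - X) + card X + m"
    using card_non_nbhd_less[OF X(1,2)] by linarith
  then show ?thesis using K X by (simp add: expansion_excess_def)
qed

context
  fixes K assumes K: "K \<subseteq> W" "10 * m \<le> card K"
begin

text \<open>The empty set competes with excess zero, whereas sizes from \<open>m\<close> to
  \<open>2 * m\<close> have positive excess.\<close>

lemma least_expanding_card_less:
  assumes "least_expanding W E m K X"
  shows "card X < m"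
proof (rule ccontr)
  assume "\<not> card X < m"
  then have "0 < expansion_excess W E K X"
    using assms by (intro expansion_excess_pos K) (auto simp: least_expanding_def)
  moreover have "expansion_excess W E K X \<le> expansion_excess W E K {}"
    using assms by (simp add: least_expanding_def)
  ultimately show False by (simp add: expansion_excess_empty)
qed

text \<open>Minimizers of a submodular function are closed under union. The union respects the size
  limit because each minimizer has fewer than \<open>m\<close> vertices.\<close>

lemma least_expanding_Un:
  assumes X: "least_expanding W E m K X" and Y: "least_expanding W E m K Y"
  shows "least_expanding W E m K (X \<union> Y)"
proof -
  have sub: "X \<subseteq> W" "Y \<subseteq> W" using X Y by (auto simp: least_expanding_def)
  have le: "card (X \<union> Y) \<le> 2 * m"
    using card_Un_le[of X Y] least_expanding_card_less[OF X] least_expanding_card_less[OF Y] by linarith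
  have "card (X \<inter> Y) \<le> card X" using sub finite_subset_W by (intro card_mono) auto
  then have "X \<inter> Y \<subseteq> W" "card (X \<inter> Y) \<le> 2 * m"
    using sub least_expanding_card_less[OF X] by auto
  then have "expansion_excess W E K Y \<le> expansion_excess W E K (X \<inter> Y)"
    using Y unfolding least_expanding_def by blast
  then have "expansion_excess W E K (X \<union> Y) \<le> expansion_excess W E K X"
    using expansion_excess_submodular[OF sub K(1)] by linarith
  then show ?thesis using X le sub unfolding least_expanding_def by (meson Un_least order_trans)
qed

text \<open>A finite nonempty family closed under binary unions contains its own union.\<close>

lemma least_expanding_bad_set: "least_expanding W E m K (bad_set W E m K)"
proof -
  let ?M = "{X. least_expanding W E m K X}"
  have fin: "finite ?M"
    by (rule finite_subset[of _ "Pow W"]) (auto simp: least_expanding_def finite_W)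
  have "?M \<noteq> {}"
  proof -
    let ?C = "{X. X \<subseteq> W \<and> card X \<le> 2 * m}"
    have "finite ?C" by (rule finite_subset[of _ "Pow W"]) (auto simp: finite_W)
    moreover have "{} \<in> ?C" by simp
    ultimately have "finite (expansion_excess W E K ` ?C)" "expansion_excess W E K ` ?C \<noteq> {}" by blast+
    from Min_in[OF this] obtain X where X: "X \<in> ?C"
      "expansion_excess W E K X = Min (expansion_excess W E K ` ?C)" by auto
    have "expansion_excess W E K X \<le> expansion_excess W E K Y" if "Y \<in> ?C" for Y
      unfolding X(2) using \<open>finite (expansion_excess W E K ` ?C)\<close> that by (intro Min_le) auto
    then have "least_expanding W E m K X" using X by (auto simp: least_expanding_def)
    then show ?thesis by auto
  qed
  with fin have "\<Union>?M \<in> ?M"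
  proof -
    have "\<Union>S \<in> ?M" if "finite S" "S \<noteq> {}" "S \<subseteq> ?M" for S
      using that by (induction S rule: finite_ne_induct) (auto intro: least_expanding_Un)
    then show ?thesis using fin \<open>?M \<noteq> {}\<close> by blast
  qed
  then show ?thesis by (simp add: bad_set_def)
qed

lemma card_bad_set_less: "card (bad_set W E m K) < m"
  by (rule least_expanding_card_less[OF least_expanding_bad_set])

text \<open>Passing from the bad set to its union with \<open>U\<close> adds \<open>card U\<close>
  vertices and cannot lower the excess. The only new outer neighbours are neighbours of
  \<open>U\<close> outside the bad set, so there must be at least \<open>2 * card U\<close> of
  them.\<close>

lemma bad_set_expansion:
  assumes U: "U \<subseteq> W - bad_set W E m K" "card U \<le> 2 * m"
  shows "2 * card U \<le> card (nbhd U \<inter> K - bad_set W E m K)"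
proof -
  let ?B = "bad_set W E m K"
  have B: "?B \<subseteq> W" by (rule bad_set_subset)
  have fin: "finite U" "finite ?B" using U B finite_subset_W[of U] finite_subset_W[of ?B] by auto
  have card: "card (U \<union> ?B) = card U + card ?B"
    using U fin by (intro card_Un_disjoint) auto
  have le: "expansion_excess W E K ?B \<le> expansion_excess W E K Y" if "Y \<subseteq> W" "card Y \<le> 2 * m" for Y
    using least_expanding_bad_set that by (auto simp: least_expanding_def)
  have "expansion_excess W E K ?B \<le> expansion_excess W E K (U \<union> ?B)"
  proof (cases "card (U \<union> ?B) \<le> 2 * m")
    case True
    then show ?thesis using U B by (intro le) auto
  next
    \<comment> \<open>Minimality does not reach this size, but the union still has fewer than
      \<open>3 * m\<close> vertices and so positive excess, while comparison with the empty set
      shows that the bad set has excess at most zero.\<close>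
    case False
    then have "0 < expansion_excess W E K (U \<union> ?B)"
      using U B card card_bad_set_less by (intro expansion_excess_pos K) auto
    moreover have "expansion_excess W E K ?B \<le> 0" using le[of "{}"] by (simp add: expansion_excess_empty)
    ultimately show ?thesis by linarith
  qed
  moreover have "card (nbhd (U \<union> ?B) \<inter> K - (U \<union> ?B)) \<le> card ((nbhd ?B \<inter> K - ?B) \<union> (nbhd U \<inter> K - ?B))"
    by (intro card_mono) (auto simp: nbhd_Un)
  moreover have "\<dots> \<le> card (nbhd ?B \<inter> K - ?B) + card (nbhd U \<inter> K - ?B)" by (rule card_Un_le)
  ultimately show ?thesis using card by (simp add: expansion_excess_def)
qed

lemma joined_graph_good: "joined_graph (W - bad_set W E m K) E m"
proof
  show "\<exists>x\<in>X. \<exists>y\<in>Y. E x y" if "X \<subseteq> W - bad_set W E m K" "Y \<subseteq> W - bad_set W E m K" "X \<inter> Y = {}"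
    "m \<le> card X" "m \<le> card Y" for X Y
    using that by (intro joined) auto
qed (use finite_W E_sym m_pos in auto)

text \<open>\<open>F\<close> avoids \<open>K\<close>, so none of the expansion into \<open>K\<close>
  is lost to occupied vertices.\<close>

lemma extendable_good:
  assumes "F \<inter> K = {}"
  shows "joined_graph.extendable (W - bad_set W E m K) E m F (\<lambda>_. 2)"
proof -
  interpret good: joined_graph "W - bad_set W E m K" E m by (rule joined_graph_good)
  show ?thesis unfolding good.extendable_def
  proof (intro allI impI)
    fix U assume U: "U \<subseteq> W - bad_set W E m K" "card U \<le> 2 * m"
    have "2 * card U \<le> card (nbhd U \<inter> K - bad_set W E m K)" using U by (rule bad_set_expansion)
    also have "\<dots> \<le> card (good.nbhd U - F)"
      using assms by (intro card_mono finite_Diff good.finite_nbhd) (auto simp: nbhd_in_def)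
    finally show "(\<Sum>x\<in>U. 2) \<le> card (good.nbhd U - F)" by (simp add: mult.commute)
  qed
qed

end

end

section \<open>The binomial random graph\<close>

definition edge_slots :: "'a set \<Rightarrow> 'a set set" where
  "edge_slots V = {e. e \<subseteq> V \<and> card e = 2}"

definition adj :: "'a set \<Rightarrow> ('a set \<Rightarrow> bool) \<Rightarrow> 'a \<Rightarrow> 'a \<Rightarrow> bool" where
  "adj V X u v \<longleftrightarrow> u \<in> V \<and> v \<in> V \<and> u \<noteq> v \<and> X {u, v}"

lemma finite_edge_slots: "finite V \<Longrightarrow> finite (edge_slots V)"
  by (rule finite_subset[of _ "Pow V"]) (auto simp: edge_slots_def)

text \<open>The slots carry independent variables with one common law, and \<open>\<sigma>\<close>
  permutes the slots among themselves.\<close>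

lemma edge_slots_relabel:
  assumes "finite V" "\<sigma> permutes V"
  shows "map_pmf (\<lambda>X. X \<circ> image \<sigma>) (Pi_pmf (edge_slots V) False (\<lambda>_. q)) = Pi_pmf (edge_slots V) False (\<lambda>_. q)"
proof -
  have inj: "inj \<sigma>" using assms(2) by (rule permutes_inj)
  have card: "card (\<sigma> ` e) = card e" for e
    by (intro card_image inj_on_subset[OF inj subset_UNIV])
  have iff: "\<sigma> ` e \<in> edge_slots V \<longleftrightarrow> e \<in> edge_slots V" for e
    using permutes_in_image[OF assms(2)] by (auto simp: edge_slots_def card)
  have "bij_betw (image \<sigma>) (edge_slots V) (edge_slots V)"
    unfolding bij_betw_def
  proof
    show inj': "inj_on ((`) \<sigma>) (edge_slots V)"
      using inj by (meson inj_image_eq_iff inj_onI)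
    have "(`) \<sigma> ` edge_slots V \<subseteq> edge_slots V" using iff by auto
    then show "(`) \<sigma> ` edge_slots V = edge_slots V"
      using inj' finite_edge_slots[OF assms(1)] by (intro endo_inj_surj)
  qed
  then show ?thesis
    using Pi_pmf_bij_betw[OF finite_edge_slots[OF assms(1)], of "image \<sigma>" "edge_slots V" False q] iff
    by simp
qed

section \<open>Probability that a given set lies in the exceptional set\<close>

lemma exists_permutation_image:
  assumes "finite J" "T \<subseteq> J" "T' \<subseteq> J" "card T = card T'"
  obtains \<sigma> where "\<sigma> permutes J" "\<sigma> ` T = T'"
proof -
  have fin: "finite T" "finite T'" using assms finite_subset by auto
  obtain f where f: "bij_betw f T T'" using finite_same_card_bij[OF fin assms(4)] by blast
  have "card (J - T) = card (J - T')" using assms fin by (simp add: card_Diff_subset)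
  then obtain g where g: "bij_betw g (J - T) (J - T')"
    using finite_same_card_bij[of "J - T" "J - T'"] assms by auto
  define \<sigma> where "\<sigma> x = (if x \<in> T then f x else if x \<in> J then g x else x)" for x
  have 1: "bij_betw \<sigma> T T'" using f by (subst bij_betw_cong[of _ _ f]) (auto simp: \<sigma>_def)
  have 2: "bij_betw \<sigma> (J - T) (J - T')" using g by (subst bij_betw_cong[of _ _ g]) (auto simp: \<sigma>_def)
  have "bij_betw \<sigma> (T \<union> (J - T)) (T' \<union> (J - T'))" using 1 2 by (rule bij_betw_combine) auto
  moreover have "T \<union> (J - T) = J" "T' \<union> (J - T') = J" using assms by auto
  ultimately have "\<sigma> permutes J" using assms by (intro bij_imp_permutes) (auto simp: \<sigma>_def)
  moreover have "\<sigma> ` T = T'" using 1 by (simp add: bij_betw_def)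
  ultimately show thesis by (rule that)
qed

text \<open>The sum is the expected number of events that occur, and never more than
  \<open>c\<close> of them occur together.\<close>

lemma sum_prob_le:
  assumes "finite I" "\<And>x. card {i\<in>I. x \<in> A i} \<le> c"
  shows "(\<Sum>i\<in>I. measure_pmf.prob M (A i)) \<le> real c"
proof -
  have int: "integrable (measure_pmf M) (indicator (A i) :: _ \<Rightarrow> real)" for i
    by (rule measure_pmf.integrable_const_bound[where B = 1]) auto
  have "(\<Sum>i\<in>I. measure_pmf.prob M (A i)) = (\<Sum>i\<in>I. measure_pmf.expectation M (indicator (A i)))"
    by simp
  also have "\<dots> = measure_pmf.expectation M (\<lambda>x. \<Sum>i\<in>I. indicator (A i) x)"
    using int by (subst Bochner_Integration.integral_sum) auto
  also have "\<dots> \<le> measure_pmf.expectation M (\<lambda>x. real c)"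
  proof (rule integral_mono)
    show "(\<Sum>i\<in>I. indicator (A i) x) \<le> real c" for x
    proof -
      have "(\<Sum>i\<in>I. indicator (A i) x) = real (card {i\<in>I. x \<in> A i})"
        using assms(1) by (simp add: indicator_def sum.If_cases Int_def)
      then show ?thesis using assms(2)[of x] by simp
    qed
  qed (use int in auto)
  finally show ?thesis by simp
qed

text \<open>The product formulas are compared factor by factor, using
  \<open>a * (m - i) \<le> a * m - i\<close>; for \<open>t > m\<close> the left side
  vanishes.\<close>

lemma binomial_scale:
  assumes "0 < a"
  shows "(m choose t) * a ^ t \<le> (a * m) choose t"
proof (cases "t \<le> m")
  case True
  then have t: "t \<le> a * m" using assms by (metis le_trans le_add1 mult_eq_if not_gr_zero)
  have "real ((m choose t) * a ^ t) = (\<Prod>i=0..<t. real (m - i) / real (t - i)) * (\<Prod>i=0..<t. real a)"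
    using binomial_altdef_of_nat[OF True, where ?'a = real] by simp
  also have "\<dots> = (\<Prod>i=0..<t. real (m - i) / real (t - i) * real a)"
    by (simp only: prod.distrib)
  also have "\<dots> \<le> (\<Prod>i=0..<t. real (a * m - i) / real (t - i))"
  proof (intro prod_mono conjI)
    fix i assume i: "i \<in> {0..<t}"
    have "i \<le> a * i" using assms by simp
    then have "(m - i) * a \<le> a * m - i"
      unfolding mult.commute[of "m - i" a] diff_mult_distrib2 by (rule diff_le_mono2)
    then have "real (m - i) * real a \<le> real (a * m - i)" by (metis of_nat_le_iff of_nat_mult)
    then show "real (m - i) / real (t - i) * real a \<le> real (a * m - i) / real (t - i)"
      by (simp add: divide_right_mono)
  qed simp
  also have "\<dots> = real ((a * m) choose t)"
    using binomial_altdef_of_nat[OF t, where ?'a = real] by simp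
  finally show ?thesis by (simp only: of_nat_le_iff)
next
  case False
  then show ?thesis by (simp add: binomial_eq_0)
qed

text \<open>Permutations of \<open>J\<close> make all its subsets with \<open>card T\<close>
  elements equally likely to lie in the bad set. When that set has fewer than \<open>m\<close>
  vertices, it contains at most \<open>m choose card T\<close> of them, so averaging gives the ratio
  of \<open>m choose card T\<close> to \<open>card J choose card T\<close>, which
  \<open>binomial_scale\<close> bounds.\<close>

lemma prob_subset_bad_set:
  assumes V: "finite V" and W: "W \<subseteq> V" "J \<subseteq> W" "K \<subseteq> W" "J \<inter> K = {}"
    and T: "T \<subseteq> J" and a: "0 < a" "a * m \<le> card J"
  shows "measure_pmf.prob (Pi_pmf (edge_slots V) False (\<lambda>_. q))
      {X. T \<subseteq> bad_set W (adj V X) m K \<and> card (bad_set W (adj V X) m K) < m} \<le> (1 / real a) ^ card T"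
proof -
  let ?M = "Pi_pmf (edge_slots V) False (\<lambda>_. q)"
  define Q where "Q T = {X. T \<subseteq> bad_set W (adj V X) m K \<and> card (bad_set W (adj V X) m K) < m}" for T
  define TT where "TT = {T'. T' \<subseteq> J \<and> card T' = card T}"
  have finJ: "finite J" and finW: "finite W" using V W by (meson finite_subset)+
  have eq: "measure_pmf.prob ?M (Q T') = measure_pmf.prob ?M (Q T)" if T': "T' \<in> TT" for T'
  proof -
    obtain \<sigma> where \<sigma>: "\<sigma> permutes J" "\<sigma> ` T' = T"
      using exists_permutation_image[OF finJ _ T] T' by (auto simp: TT_def)
    have perm: "\<sigma> permutes W" "\<sigma> permutes V" using \<sigma>(1) W by (auto intro: permutes_subset)
    have "\<sigma> x = x" if "x \<in> K" for x using permutes_not_in[OF \<sigma>(1)] that W(4) by blast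
    then have K: "\<sigma> ` K = K" by simp
    have adj: "adj V (X \<circ> image \<sigma>) = (\<lambda>x y. adj V X (\<sigma> x) (\<sigma> y))" for X
      using permutes_in_image[OF perm(2)] permutes_inj[OF perm(2)]
      by (auto simp: adj_def fun_eq_iff inj_eq)
    have "measure_pmf.prob ?M (Q T') = measure_pmf.prob (map_pmf (\<lambda>X. X \<circ> image \<sigma>) ?M) (Q T')"
      using edge_slots_relabel[OF V perm(2)] by simp
    also have "\<dots> = measure_pmf.prob ?M ((\<lambda>X. X \<circ> image \<sigma>) -` Q T')" by simp
    also have "(\<lambda>X. X \<circ> image \<sigma>) -` Q T' = Q T"
      by (simp add: Q_def vimage_def adj bad_set_relabel[OF perm(1) K] \<sigma>(2))
    finally show ?thesis .
  qed
  have "card TT = card J choose card T"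
    unfolding TT_def by (rule n_subsets[OF finJ])
  then have "real (card J choose card T) * measure_pmf.prob ?M (Q T) = (\<Sum>T'\<in>TT. measure_pmf.prob ?M (Q T'))"
    using eq by simp
  also have "\<dots> \<le> real (m choose card T)"
  proof (rule sum_prob_le)
    show "finite TT" using finJ by (simp add: TT_def)
    fix X
    let ?B = "bad_set W (adj V X) m K"
    show "card {T' \<in> TT. X \<in> Q T'} \<le> m choose card T"
    proof (cases "card ?B < m")
      case True
      have finB: "finite ?B" using bad_set_subset finW by (rule finite_subset)
      have "card {T' \<in> TT. X \<in> Q T'} \<le> card {T'. T' \<subseteq> ?B \<and> card T' = card T}"
        using finB by (intro card_mono) (auto simp: TT_def Q_def)
      also have "\<dots> = card ?B choose card T" by (rule n_subsets[OF finB])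
      also have "\<dots> \<le> m choose card T" using True by (intro binomial_right_mono) auto
      finally show ?thesis .
    qed (simp add: Q_def)
  qed
  finally have 1: "real (card J choose card T) * measure_pmf.prob ?M (Q T) \<le> real (m choose card T)" .
  have "(m choose card T) * a ^ card T \<le> (a * m) choose card T" by (rule binomial_scale[OF a(1)])
  also have "\<dots> \<le> card J choose card T" using a(2) by (rule binomial_right_mono)
  finally have "real (m choose card T) * real a ^ card T \<le> real (card J choose card T)"
    by (metis of_nat_le_iff of_nat_mult of_nat_power)
  moreover have pos: "0 < real (card J choose card T)"
    using card_mono[OF finJ T] by (simp add: zero_less_binomial)
  ultimately have "measure_pmf.prob ?M (Q T) * real a ^ card T \<le> 1"
  proof -
    assume le: "real (m choose card T) * real a ^ card T \<le> real (card J choose card T)"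
    have "real (card J choose card T) * (measure_pmf.prob ?M (Q T) * real a ^ card T)
        \<le> real (m choose card T) * real a ^ card T"
      using mult_right_mono[OF 1, of "real a ^ card T"] by (simp add: mult_ac)
    then have "real (card J choose card T) * (measure_pmf.prob ?M (Q T) * real a ^ card T)
        \<le> real (card J choose card T) * 1" using le by linarith
    then show ?thesis using pos by (simp only: mult_le_cancel_left_pos)
  qed
  then show ?thesis using a(1) by (simp add: Q_def power_one_over field_simps)
qed

text \<open>Union bound over at most \<open>2 ^ card V * 2 ^ card V\<close> pairs; for a disjoint
  pair the \<open>m * m\<close> connecting slots are distinct and independent.\<close>

lemma prob_not_joined:
  assumes V: "finite V" and p: "0 \<le> p" "p \<le> 1"
  shows "measure_pmf.prob (Pi_pmf (edge_slots V) False (\<lambda>_. bernoulli_pmf p))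
      {X. \<exists>A B. A \<subseteq> V \<and> B \<subseteq> V \<and> A \<inter> B = {} \<and> card A = m \<and> card B = m \<and> (\<forall>x\<in>A. \<forall>y\<in>B. \<not> adj V X x y)}
    \<le> 4 ^ card V * (1 - p) ^ (m * m)"
proof -
  let ?S = "edge_slots V"
  let ?M = "Pi_pmf ?S False (\<lambda>_. bernoulli_pmf p)"
  define I where "I = {(A, B). A \<subseteq> V \<and> B \<subseteq> V \<and> A \<inter> B = {} \<and> card A = m \<and> card B = m}"
  define N where "N = (\<lambda>(A, B). {X. \<forall>x\<in>A. \<forall>y\<in>B. \<not> adj V X x y})"
  have sub: "I \<subseteq> Pow V \<times> Pow V" by (auto simp: I_def)
  have finI: "finite I" using V by (intro finite_subset[OF sub] finite_cartesian_product) auto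
  have "card I \<le> card (Pow V \<times> Pow V)" using sub V by (intro card_mono) auto
  also have "\<dots> = 4 ^ card V" using V by (simp add: card_cartesian_product card_Pow flip: power_mult_distrib)
  finally have cardI: "card I \<le> 4 ^ card V" .
  have probN: "measure_pmf.prob ?M (N i) = (1 - p) ^ (m * m)" if i: "i \<in> I" for i
  proof -
    obtain A B where i_eq: "i = (A, B)" by (cases i)
    have AB: "A \<subseteq> V" "B \<subseteq> V" "A \<inter> B = {}" "card A = m" "card B = m" using i by (auto simp: I_def i_eq)
    define c where "c = (\<lambda>(x, y). {x, y}) ` (A \<times> B)"
    have "inj_on (\<lambda>(x, y). {x, y}) (A \<times> B)"
      using AB(3) by (auto simp: inj_on_def doubleton_eq_iff)
    then have card_c: "card c = m * m" unfolding c_def using AB by (simp add: card_image card_cartesian_product)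
    have ne: "x \<noteq> y" if "x \<in> A" "y \<in> B" for x y using AB(3) that by auto
    have cS: "c \<subseteq> ?S" using AB ne by (auto simp: c_def edge_slots_def)
    \<comment> \<open>\<open>D\<close> expresses that all slots in \<open>c\<close> are empty as a
      product event, with the other slots left free.\<close>
    define D where "D = (\<lambda>e. if e \<in> c then {False} else UNIV)"
    have adj: "adj V X x y \<longleftrightarrow> X {x, y}" if "x \<in> A" "y \<in> B" for X x y
      using ne[OF that] that AB by (auto simp: adj_def)
    have "N i = {X. \<forall>e\<in>c. \<not> X e}" by (auto simp: N_def i_eq c_def adj)
    also have "\<dots> = Pi ?S D" using cS by (auto simp: Pi_def D_def)
    finally have "N i = Pi ?S D" .
    then have "measure_pmf.prob ?M (N i) = (\<Prod>e\<in>?S. measure_pmf.prob (bernoulli_pmf p) (D e))"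
      using measure_Pi_pmf_Pi[OF finite_edge_slots[OF V]] by simp
    also have "\<dots> = (\<Prod>e\<in>?S. if e \<in> c then 1 - p else 1)"
      using p by (intro prod.cong) (auto simp: D_def measure_pmf_single)
    also have "\<dots> = (1 - p) ^ card c"
      using cS finite_edge_slots[OF V] by (simp add: prod.If_cases Int_absorb1)
    finally show ?thesis by (simp add: card_c)
  qed
  have "{X. \<exists>A B. A \<subseteq> V \<and> B \<subseteq> V \<and> A \<inter> B = {} \<and> card A = m \<and> card B = m \<and> (\<forall>x\<in>A. \<forall>y\<in>B. \<not> adj V X x y)}
      = (\<Union>i\<in>I. N i)" by (auto simp: I_def N_def)
  also have "measure_pmf.prob ?M \<dots> \<le> (\<Sum>i\<in>I. measure_pmf.prob ?M (N i))"
    using finI by (intro measure_pmf.finite_measure_subadditive_finite) auto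
  also have "\<dots> = real (card I) * (1 - p) ^ (m * m)" using probN by simp
  also have "\<dots> \<le> real (4 ^ card V) * (1 - p) ^ (m * m)"
    using cardI p by (intro mult_right_mono zero_le_power) (simp_all only: of_nat_le_iff diff_ge_0_iff_ge)
  finally show ?thesis by simp
qed

section \<open>Disjoint stars\<close>

text \<open>Centres and leaves have separate host sets \<open>S\<close> and \<open>L\<close> because
  the greedy argument puts centres inside a set and leaves outside it.\<close>

definition star_family :: "('a \<Rightarrow> 'a \<Rightarrow> bool) \<Rightarrow> nat \<Rightarrow> 'a set \<Rightarrow> 'a set \<Rightarrow> 'a set \<Rightarrow> ('a \<Rightarrow> 'a set) \<Rightarrow> bool" where
  "star_family E s S L Z A \<longleftrightarrow> finite Z \<and> Z \<subseteq> S \<and> (\<forall>u\<in>Z. A u \<subseteq> L \<and> card (A u) = s \<and> (\<forall>y\<in>A u. E u y)) \<and>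
     disjoint_family_on A Z \<and> Z \<inter> (\<Union>u\<in>Z. A u) = {}"

lemma star_family_empty: "star_family E s S L {} A"
  by (simp add: star_family_def disjoint_family_on_def)

lemma star_family_mono:
  "star_family E s S L Z A \<Longrightarrow> S \<subseteq> S' \<Longrightarrow> L \<subseteq> L' \<Longrightarrow> star_family E s S' L' Z A"
  unfolding star_family_def by (meson subset_trans)

lemma star_family_insert:
  assumes ZA: "star_family E s S L Z A" and x: "x \<in> S - Z - (\<Union>u\<in>Z. A u)"
    and B: "B \<subseteq> L - insert x Z - (\<Union>u\<in>Z. A u)" "card B = s" "\<forall>y\<in>B. E x y"
  shows "star_family E s S L (insert x Z) (A(x := B))"
proof -
  have U: "(\<Union>u\<in>insert x Z. (A(x := B)) u) = B \<union> (\<Union>u\<in>Z. A u)"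
    using x by (auto split: if_splits)
  have "disjoint_family_on (A(x := B)) (insert x Z)"
    unfolding disjoint_family_on_def
  proof (intro ballI impI)
    fix u v assume uv: "u \<in> insert x Z" "v \<in> insert x Z" "u \<noteq> v"
    have "A u \<inter> A v = {}" if "u \<in> Z" "v \<in> Z"
      using ZA that uv(3) by (auto simp: star_family_def disjoint_family_on_def)
    moreover have "B \<inter> A w = {}" if "w \<in> Z" for w using B(1) that by blast
    ultimately show "(A(x := B)) u \<inter> (A(x := B)) v = {}"
      using uv by (cases "u = x"; cases "v = x") (simp_all add: Int_commute)
  qed
  moreover have "insert x Z \<inter> (B \<union> (\<Union>u\<in>Z. A u)) = {}"
    using ZA x B by (auto simp: star_family_def)
  ultimately show ?thesis
    using ZA x B unfolding star_family_def U by (simp add: subset_iff)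
qed

lemma star_family_card_UN:
  assumes "star_family E s S L Z A" "finite L"
  shows "card (\<Union>u\<in>Z. A u) = card Z * s"
proof -
  have "card (\<Union>u\<in>Z. A u) = (\<Sum>u\<in>Z. card (A u))"
    using assms by (intro card_UN_disjoint)
      (auto simp: star_family_def disjoint_family_on_def dest: finite_subset)
  also have "\<dots> = (\<Sum>u\<in>Z. s)" using assms by (intro sum.cong) (auto simp: star_family_def)
  finally show ?thesis by simp
qed

text \<open>If a maximal family of stars is too small, then its vertex set receives so many edges from
  the rest of the graph that new stars centred in that set can be chosen greedily.\<close>
lemma star_family_exists:
  assumes V: "finite V" and sym: "\<And>x y. E x y \<Longrightarrow> E y x" and irrefl: "\<And>x. \<not> E x x"
    and deg: "\<And>x. x \<in> V \<Longrightarrow> d \<le> card {y\<in>V. E x y}"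
    and large: "r * (s + 1) * s < (card V - r * (2 * s + 1)) * (d - s - r)"
  shows "\<exists>Z A. star_family E s V V Z A \<and> card Z = r"
proof (rule ccontr)
  assume not: "\<not> ?thesis"
  define P where "P j \<longleftrightarrow> (\<exists>Z A. star_family E s V V Z A \<and> card Z = j)" for j
  have "P 0" unfolding P_def using star_family_empty by (metis card.empty)
  moreover have "\<not> P r" using not by (simp add: P_def)
  \<comment> \<open>A size that is attained while the next one is not: a family of this size cannot
    be enlarged.\<close>
  ultimately have "\<exists>j<r. P j \<and> \<not> P (Suc j)"
    using dec_induct[of 0 r P] by blast
  then obtain j where j: "j < r" "P j" "\<not> P (Suc j)" by blast
  obtain Z0 A0 where Z0: "star_family E s V V Z0 A0" "card Z0 = j"
    using j(2) unfolding P_def by blast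
  define C where "C = Z0 \<union> (\<Union>u\<in>Z0. A0 u)"
  have CV: "C \<subseteq> V" using Z0 by (auto simp: C_def star_family_def)
  have finC: "finite C" using CV V by (rule finite_subset)
  have "card C \<le> j + j * s"
    using card_Un_le[of Z0 "\<Union>u\<in>Z0. A0 u"] star_family_card_UN[OF Z0(1) V] Z0(2) by (simp add: C_def)
  also have "\<dots> = j * (s + 1)" by simp
  also have "\<dots> \<le> r * (s + 1)" using j by (intro mult_right_mono) auto
  finally have cardC: "card C \<le> r * (s + 1)" .
  \<comment> \<open>With \<open>s\<close> neighbours outside \<open>C\<close>, the vertex
    \<open>w\<close> would be the centre of a further star.\<close>
  have outside: "d - s \<le> card {y\<in>C. E w y}" if w: "w \<in> V - C" for w
  proof -
    have "card {y\<in>V - C. E w y} < s"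
    proof (rule ccontr)
      assume "\<not> ?thesis"
      then have "s \<le> card {y\<in>V - C. E w y}" by simp
      then obtain B where B: "B \<subseteq> {y\<in>V - C. E w y}" "card B = s" by (meson obtain_subset_with_card_n)
      have "star_family E s V V (insert w Z0) (A0(w := B))"
        using w B irrefl by (intro star_family_insert[OF Z0(1)]) (auto simp: C_def)
      moreover have "card (insert w Z0) = Suc j"
        using Z0 w by (auto simp: C_def star_family_def)
      ultimately show False using j by (auto simp: P_def)
    qed
    moreover have split: "{y\<in>V. E w y} = {y\<in>C. E w y} \<union> {y\<in>V - C. E w y}" using CV by auto
    have "card {y\<in>V. E w y} \<le> card {y\<in>C. E w y} + card {y\<in>V - C. E w y}"
      unfolding split by (rule card_Un_le)
    moreover have "d \<le> card {y\<in>V. E w y}" using deg w by simp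
    ultimately show ?thesis by linarith
  qed
  have "\<exists>Z A. star_family E s C (V - C) Z A \<and> card Z = i" if "i \<le> r" for i
    using that
  proof (induction i)
    case 0
    show ?case using star_family_empty[of E s C "V - C"] by (intro exI[of _ "{}"]) auto
  next
    case (Suc i)
    then obtain Z A where Z: "star_family E s C (V - C) Z A" "card Z = i" by auto
    define W where "W = V - C - (\<Union>u\<in>Z. A u)"
    have AV: "(\<Union>u\<in>Z. A u) \<subseteq> V - C" using Z by (auto simp: star_family_def)
    have ZC: "Z \<subseteq> C" "finite Z" using Z by (auto simp: star_family_def)
    have fin: "finite W" using V by (simp add: W_def)
    have "card W = card V - card C - i * s"
      using star_family_card_UN[OF Z(1)] V CV finC AV Z(2)
      by (simp add: W_def card_Diff_subset finite_subset[OF AV])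
    moreover have "i * s \<le> r * s" using Suc.prems by (intro mult_right_mono) auto
    moreover have "r * (2 * s + 1) = r * (s + 1) + r * s" by (simp add: algebra_simps)
    ultimately have cardW: "card V - r * (2 * s + 1) \<le> card W" using cardC by linarith
    \<comment> \<open>Double counting of the edges between \<open>W\<close> and
      \<open>C - Z\<close>: each \<open>w\<close> has at least \<open>d - s\<close> neighbours in
      \<open>C\<close>, at most \<open>r\<close> of them used centres, so low degrees throughout
      \<open>C - Z\<close> would contradict \<open>large\<close>.\<close>
    have "\<exists>x\<in>C - Z. s \<le> card {w\<in>W. E x w}"
    proof (rule ccontr)
      assume "\<not> ?thesis"
      then have less: "card {w\<in>W. E x w} \<le> s" if "x \<in> C - Z" for x using that by (meson less_imp_le not_le)
      have "(card V - r * (2 * s + 1)) * (d - s - r) \<le> card W * (d - s - r)"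
        using cardW by (intro mult_right_mono) auto
      also have "\<dots> = (\<Sum>w\<in>W. d - s - r)" by simp
      also have "\<dots> \<le> (\<Sum>w\<in>W. card {x\<in>C - Z. E w x})"
      proof (rule sum_mono)
        fix w assume "w \<in> W"
        then have "d - s \<le> card {y\<in>C. E w y}" by (intro outside) (auto simp: W_def)
        also have "\<dots> \<le> card ({x\<in>C - Z. E w x} \<union> Z)" using finC ZC by (intro card_mono) auto
        also have "\<dots> \<le> card {x\<in>C - Z. E w x} + i" using card_Un_le[of _ Z] Z(2) by simp
        finally show "d - s - r \<le> card {x\<in>C - Z. E w x}" using Suc.prems by linarith
      qed
      also have "\<dots> = (\<Sum>x\<in>C - Z. card {w\<in>W. E w x})"
        using fin finC by (intro sum_multicount_gen) auto
      also have "\<dots> = (\<Sum>x\<in>C - Z. card {w\<in>W. E x w})"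
        using sym by (intro sum.cong arg_cong[of _ _ card]) auto
      also have "\<dots> \<le> (\<Sum>x\<in>C - Z. s)" using less by (rule sum_mono)
      also have "\<dots> \<le> r * (s + 1) * s"
        using cardC card_mono[OF finC, of "C - Z"] by (simp del: mult_Suc_right add_Suc_right)
      finally show False using large by simp
    qed
    then obtain x where x: "x \<in> C - Z" and "s \<le> card {w\<in>W. E x w}" by blast
    then obtain B where B: "B \<subseteq> {w\<in>W. E x w}" "card B = s" by (meson obtain_subset_with_card_n)
    have "star_family E s C (V - C) (insert x Z) (A(x := B))"
      using x B AV ZC by (intro star_family_insert[OF Z(1)]) (auto simp: W_def)
    moreover have "card (insert x Z) = Suc i" using x Z ZC by simp
    ultimately show ?case by blast
  qed
  then obtain Z A where "star_family E s C (V - C) Z A" "card Z = r" by blast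
  then have "P r" unfolding P_def using CV star_family_mono[of E s C "V - C" Z A V V] by blast
  with \<open>\<not> P r\<close> show False ..
qed

section \<open>Clique subdivisions from paths\<close>

fun path_arcs :: "'a list \<Rightarrow> ('a \<times> 'a) set" where
  "path_arcs (x # y # zs) = {(x, y), (y, x)} \<union> path_arcs (y # zs)"
| "path_arcs _ = {}"

lemma path_arcs_subset:
  "successively (\<lambda>x y. (x, y) \<in> A \<and> (y, x) \<in> A) xs \<Longrightarrow> path_arcs xs \<subseteq> A"
  by (induction xs rule: path_arcs.induct) auto

text \<open>Ensures that a path with inner vertices contains no direct arc between branch vertices,
  so replacing further clique edges leaves it intact.\<close>

lemma path_arcs_inner:
  assumes "ws \<noteq> []" "(x, y) \<in> path_arcs (u # ws @ [v])"
  shows "x \<in> set ws \<or> y \<in> set ws"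
  using assms
proof (induction ws arbitrary: u)
  case (Cons w ws)
  then show ?case by (cases "ws = []") auto
qed simp

text \<open>The first inner vertex \<open>w\<close> subdivides \<open>(u, v)\<close>, and the
  remaining ones are inserted into the new edge \<open>(w, v)\<close>.\<close>

lemma subdivision_pair_path:
  assumes "subdivision_pair K H" "(u, v) \<in> parcs H" "distinct ws" "set ws \<inter> pverts H = {}"
  shows "subdivision_pair K \<lparr>pverts = pverts H \<union> set ws,
    parcs = parcs H - {(u, v), (v, u)} \<union> path_arcs (u # ws @ [v])\<rparr>"
  using assms
proof (induction ws arbitrary: H u)
  case Nil
  interpret pair_bidirected_digraph H using Nil(1) by (rule bidirected_digraphI_subdivision)
  have "(v, u) \<in> parcs H" using Nil(2) by (simp add: arcs_symmetric)
  then have "parcs H - {(u, v), (v, u)} \<union> path_arcs (u # [] @ [v]) = parcs H" using Nil(2) by auto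
  then have "\<lparr>pverts = pverts H \<union> set [], parcs = parcs H - {(u, v), (v, u)} \<union> path_arcs (u # [] @ [v])\<rparr> = H"
    by simp
  then show ?case using Nil(1) by simp
next
  case (Cons w ws)
  interpret pair_bidirected_digraph H using Cons.prems(1) by (rule bidirected_digraphI_subdivision)
  let ?H = "subdivide H (u, v) w"
  have w: "w \<notin> pverts H" using Cons.prems by auto
  have sd: "subdivision_pair K ?H"
    using Cons.prems w by (intro subdivision_pair_divide) auto
  have nw: "(w, x) \<notin> parcs H" "(x, w) \<notin> parcs H" for x
    using w by (auto dest: wellformed')
  have uv: "u \<noteq> v" using Cons.prems(2) by (auto dest: adj_not_same)
  have "subdivision_pair K \<lparr>pverts = pverts ?H \<union> set ws,
    parcs = parcs ?H - {(w, v), (v, w)} \<union> path_arcs (w # ws @ [v])\<rparr>"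
    using Cons.prems by (intro Cons.IH sd) auto
  also have "pverts ?H \<union> set ws = pverts H \<union> set (w # ws)" by auto
  also have "parcs ?H - {(w, v), (v, w)} \<union> path_arcs (w # ws @ [v])
      = parcs H - {(u, v), (v, u)} \<union> path_arcs (u # (w # ws) @ [v])"
    using nw uv by auto
  finally show ?case .
qed

text \<open>Each edge is to be replaced only once, so it is indexed by its increasing orientation;
  this is the use of the linear order. \<open>Q\<close> collects the edges replaced so far.\<close>

lemma subdivision_pair_clique:
  fixes Z :: "'a :: linorder set"
  assumes Z: "finite Z" and Q: "finite Q" "Q \<subseteq> {(u, v). u \<in> Z \<and> v \<in> Z \<and> u < v}"
    and q: "\<And>i. i \<in> Q \<Longrightarrow> q i \<noteq> [] \<and> distinct (q i) \<and> set (q i) \<inter> Z = {}"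
    and disj: "disjoint_family_on (\<lambda>i. set (q i)) Q"
  shows "subdivision_pair \<lparr>pverts = Z, parcs = {(u, v). u \<in> Z \<and> v \<in> Z \<and> u \<noteq> v}\<rparr>
    \<lparr>pverts = Z \<union> (\<Union>i\<in>Q. set (q i)), parcs = {(u, v). u \<in> Z \<and> v \<in> Z \<and> u \<noteq> v} - Q - Q\<inverse> \<union>
       (\<Union>i\<in>Q. path_arcs (fst i # q i @ [snd i]))\<rparr>"
  using Q q disj
proof (induction Q rule: finite_induct)
  case empty
  let ?K = "\<lparr>pverts = Z, parcs = {(u, v). u \<in> Z \<and> v \<in> Z \<and> u \<noteq> v}\<rparr>"
  have "K\<^bsub>card Z\<^esub> (with_proj ?K)" using Z by (auto simp: complete_digraph_pair_def)
  then interpret pair_graph ?K by (rule pair_graphI_complete)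
  have "pair_bidirected_digraph ?K" by unfold_locales
  moreover have "Z \<union> (\<Union>i\<in>{}. set (q i)) = Z" by auto
  moreover have "parcs ?K - {} - {}\<inverse> \<union> (\<Union>i\<in>{}. path_arcs (fst i # q i @ [snd i])) = parcs ?K" by auto
  ultimately show ?case using subdivision_pair_base[of ?K]
    by (simp only: pair_pre_digraph.simps)
next
  case (insert i Q)
  obtain u v where i: "i = (u, v)" by (cases i)
  have uv: "u \<in> Z" "v \<in> Z" "u < v" using insert.prems(1) by (auto simp: i)
  let ?A = "{(u, v). u \<in> Z \<and> v \<in> Z \<and> u \<noteq> v}"
  let ?H = "\<lparr>pverts = Z \<union> (\<Union>i\<in>Q. set (q i)), parcs = ?A - Q - Q\<inverse> \<union>
       (\<Union>i\<in>Q. path_arcs (fst i # q i @ [snd i]))\<rparr>"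
  have notin: "(x, y) \<notin> path_arcs (fst j # q j @ [snd j])" if "j \<in> Q" "x \<in> Z" "y \<in> Z" for x y j
  proof -
    have "q j \<noteq> []" "set (q j) \<inter> Z = {}" using insert.prems(2)[of j] that(1) by auto
    then show ?thesis using path_arcs_inner[of "q j" x y "fst j" "snd j"] that by blast
  qed
  have "subdivision_pair \<lparr>pverts = Z, parcs = ?A\<rparr> ?H"
  proof (rule insert.IH)
    show "disjoint_family_on (\<lambda>i. set (q i)) Q"
      using insert.prems(3) by (rule disjoint_family_on_mono[rotated]) auto
  qed (use insert.prems in auto)
  then have "subdivision_pair \<lparr>pverts = Z, parcs = ?A\<rparr> \<lparr>pverts = pverts ?H \<union> set (q i),
    parcs = parcs ?H - {(u, v), (v, u)} \<union> path_arcs (u # q i @ [v])\<rparr>"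
  proof (rule subdivision_pair_path)
    have "(u, v) \<notin> Q" using insert.hyps by (simp add: i)
    moreover have "(v, u) \<notin> Q" using insert.prems(1) uv by auto
    ultimately show "(u, v) \<in> parcs ?H" using uv by auto
    show "set (q i) \<inter> pverts ?H = {}"
      using insert.prems(2)[of i] insert.prems(3) insert.hyps(2) by (auto simp: disjoint_family_on_def)
  qed (use insert.prems in auto)
  also have "pverts ?H \<union> set (q i) = Z \<union> (\<Union>i\<in>insert i Q. set (q i))" by auto
  also have "parcs ?H - {(u, v), (v, u)} \<union> path_arcs (u # q i @ [v]) =
    ?A - insert i Q - (insert i Q)\<inverse> \<union> (\<Union>i\<in>insert i Q. path_arcs (fst i # q i @ [snd i]))"
    using notin[OF _ uv(1,2)] notin[OF _ uv(2,1)] by (auto simp: i)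
  finally show ?case .
qed

theorem contains_clique_subdivisionI:
  fixes Z :: "'a :: linorder set"
  assumes G: "pair_wf_digraph G" and Z: "finite Z" "Z \<subseteq> pverts G"
    and q: "\<And>u v. u \<in> Z \<Longrightarrow> v \<in> Z \<Longrightarrow> u < v \<Longrightarrow> q (u, v) \<noteq> [] \<and> distinct (q (u, v)) \<and>
      set (q (u, v)) \<subseteq> pverts G - Z \<and>
      successively (\<lambda>x y. (x, y) \<in> parcs G \<and> (y, x) \<in> parcs G) (u # q (u, v) @ [v])"
    and disj: "disjoint_family_on (\<lambda>i. set (q i)) {(u, v). u \<in> Z \<and> v \<in> Z \<and> u < v}"
  shows "contains_clique_subdivision (with_proj G) (card Z)"
proof -
  let ?Q = "{(u, v). u \<in> Z \<and> v \<in> Z \<and> u < v}"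
  let ?K = "\<lparr>pverts = Z, parcs = {(u, v). u \<in> Z \<and> v \<in> Z \<and> u \<noteq> v}\<rparr>"
  let ?H = "\<lparr>pverts = Z \<union> (\<Union>i\<in>?Q. set (q i)), parcs = {(u, v). u \<in> Z \<and> v \<in> Z \<and> u \<noteq> v} - ?Q - ?Q\<inverse> \<union>
       (\<Union>i\<in>?Q. path_arcs (fst i # q i @ [snd i]))\<rparr>"
  have K: "K\<^bsub>card Z\<^esub> (with_proj ?K)" using Z by (auto simp: complete_digraph_pair_def)
  have finQ: "finite ?Q" by (rule finite_subset[of _ "Z \<times> Z"]) (use Z in auto)
  have sd: "subdivision_pair ?K ?H"
    using Z finQ q disj by (intro subdivision_pair_clique) auto
  interpret H: pair_bidirected_digraph ?H using sd by (rule bidirected_digraphI_subdivision)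
  have "path_arcs (fst i # q i @ [snd i]) \<subseteq> parcs G" if "i \<in> ?Q" for i
    using q that by (intro path_arcs_subset) auto
  \<comment> \<open>With all pairs replaced, no arc of the original clique is left, so only path
    arcs have to be found in \<open>G\<close>.\<close>
  moreover have "{(u, v). u \<in> Z \<and> v \<in> Z \<and> u \<noteq> v} - ?Q - ?Q\<inverse> = {}" by auto
  ultimately have "parcs ?H \<subseteq> parcs G" by auto
  moreover have "pverts ?H \<subseteq> pverts G" using Z q by auto
  ultimately have "subgraph (with_proj ?H) (with_proj G)"
    using G H.wf_digraph_axioms by (auto simp: subgraph_def wf_digraph_wp_iff)
  then show ?thesis using sd K unfolding contains_clique_subdivision_def by blast
qed

section \<open>Combining the two graphs\<close>

lemma adj_commute: "adj V X u v \<longleftrightarrow> adj V X v u"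
  by (auto simp: adj_def insert_commute)

definition graph_of_slots :: "'a set \<Rightarrow> ('a set \<Rightarrow> bool) \<Rightarrow> 'a pair_pre_digraph" where
  "graph_of_slots V X = \<lparr>pverts = V, parcs = {(u, v). u \<in> V \<and> v \<in> V \<and> u \<noteq> v \<and> X {u, v}}\<rparr>"

lemma binomial_random_graph_conv:
  "binomial_random_graph V p = map_pmf (graph_of_slots V) (Pi_pmf (edge_slots V) False (\<lambda>_. bernoulli_pmf p))"
  by (simp add: binomial_random_graph_def graph_of_slots_def[abs_def] edge_slots_def)

lemma union_with_proj:
  "union (with_proj G) (with_proj H) = with_proj \<lparr>pverts = pverts G \<union> pverts H, parcs = parcs G \<union> parcs H\<rparr>"
  by (simp add: union_def with_proj_def)

text \<open>Exact sizes suit the union bound; larger sets reduce to them by passing to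
  subsets.\<close>

definition joined_pairs :: "'a set \<Rightarrow> nat \<Rightarrow> ('a \<Rightarrow> 'a \<Rightarrow> bool) \<Rightarrow> bool" where
  "joined_pairs V m E \<longleftrightarrow>
     (\<forall>A B. A \<subseteq> V \<longrightarrow> B \<subseteq> V \<longrightarrow> A \<inter> B = {} \<longrightarrow> card A = m \<longrightarrow> card B = m \<longrightarrow> (\<exists>x\<in>A. \<exists>y\<in>B. E x y))"

lemma joined_graph_adj:
  assumes "finite V" "W \<subseteq> V" "0 < m" "joined_pairs V m (adj V X)"
  shows "joined_graph W (adj V X) m"
proof
  show "finite W" using assms(1,2) by (rule rev_finite_subset)
  fix A B assume AB: "A \<subseteq> W" "B \<subseteq> W" "A \<inter> B = {}" "m \<le> card A" "m \<le> card B"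
  obtain A' where A': "A' \<subseteq> A" "card A' = m" using AB(4) by (meson obtain_subset_with_card_n)
  obtain B' where B': "B' \<subseteq> B" "card B' = m" using AB(5) by (meson obtain_subset_with_card_n)
  have "A' \<subseteq> V" "B' \<subseteq> V" "A' \<inter> B' = {}" using A' B' AB assms(2) by auto
  then have "\<exists>x\<in>A'. \<exists>y\<in>B'. adj V X x y"
    using assms(4) A' B' unfolding joined_pairs_def by blast
  then show "\<exists>x\<in>A. \<exists>y\<in>B. adj V X x y" using A' B' by blast
next
  show "adj V X y x" if "adj V X x y" for x y using that adj_commute[of V X x y] by simp
qed (rule assms(3))

text \<open>The deterministic part. Each centre \<open>u\<close> assigns a leaf \<open>g u v\<close>
  outside the bad set to every other centre \<open>v\<close>, and for \<open>u < v\<close> a path in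
  the random graph links \<open>g u v\<close> to \<open>g v u\<close>. The reserve is
  \<open>8 * m\<close> instead of \<open>7 * m\<close> because the bad set takes fewer than
  \<open>m\<close> vertices away from \<open>W\<close>.\<close>

lemma clique_subdivision_if_good:
  fixes V :: "'a :: linorder set"
  assumes G: "pair_graph G" "pverts G = V"
    and ZA: "star_family (\<lambda>x y. (x, y) \<in> parcs G) s V V Z A" "card Z = r"
    and W: "W = V - Z" and J: "(\<Union>u\<in>Z. A u) \<subseteq> J" "J \<subseteq> W" and K: "K = W - J" "10 * m \<le> card K"
    and m: "0 < m" "joined_pairs V m (adj V X)"
    and good: "\<And>u. u \<in> Z \<Longrightarrow> r - 1 \<le> card (A u - bad_set W (adj V X) m K)"
    and k: "m \<le> 2 ^ k" "r * s + r * r * (2 * k) + 2 * 2 ^ (k + 1) + 8 * m \<le> card W"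
  shows "contains_clique_subdivision (union (with_proj G) (with_proj (graph_of_slots V X))) r"
proof -
  interpret G: pair_graph G by (rule G)
  have finV: "finite V" using G.finite_verts G(2) by simp
  have finZ: "finite Z" and ZV: "Z \<subseteq> V" using ZA by (auto simp: star_family_def)
  let ?E = "adj V X" and ?B = "bad_set W (adj V X) m K"
  interpret W: joined_graph W ?E m by (rule joined_graph_adj) (use finV W m in auto)
  have KW: "K \<subseteq> W" using K by auto
  interpret good: joined_graph "W - ?B" ?E m by (rule W.joined_graph_good) fact+
  define F where "F = (\<Union>u\<in>Z. A u) - ?B"
  have "\<exists>g. g ` (Z - {u}) \<subseteq> A u - ?B \<and> inj_on g (Z - {u})" if u: "u \<in> Z" for u
  proof (rule card_le_inj)
    have "A u \<subseteq> V" using ZA u by (simp add: star_family_def)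
    then show "finite (A u - ?B)" using finV by (intro finite_Diff) (rule finite_subset)
    show "card (Z - {u}) \<le> card (A u - ?B)" using good[OF u] ZA(2) u finZ by simp
  qed (use finZ in auto)
  then obtain g where g: "\<And>u. u \<in> Z \<Longrightarrow> g u ` (Z - {u}) \<subseteq> A u - ?B \<and> inj_on (g u) (Z - {u})"
    by metis
  have gA: "g u v \<in> A u" "g u v \<in> F" if "u \<in> Z" "v \<in> Z" "u \<noteq> v" for u v
    using g[of u] that by (auto simp: F_def)
  have g_eq: "u = u' \<and> v = v'"
    if "g u v = g u' v'" "u \<in> Z" "v \<in> Z" "u \<noteq> v" "u' \<in> Z" "v' \<in> Z" "u' \<noteq> v'" for u v u' v'
  proof -
    have "u = u'"
    proof (rule ccontr)
      assume "u \<noteq> u'"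
      then have "A u \<inter> A u' = {}" using ZA(1) that by (auto simp: star_family_def disjoint_family_on_def)
      then show False using gA(1)[of u v] gA(1)[of u' v'] that by auto
    qed
    moreover have "v = v'" using g[OF that(2)] that \<open>u = u'\<close> by (auto simp: inj_on_def)
    ultimately show ?thesis ..
  qed
  define I where "I = {(u, v). u \<in> Z \<and> v \<in> Z \<and> u < v}"
  define a where "a = (\<lambda>(u, v). g u v)"
  define b where "b = (\<lambda>(u, v). g v u)"
  have IZ: "I \<subseteq> Z \<times> Z" by (auto simp: I_def)
  have finI: "finite I" using finite_subset[OF IZ] finZ by simp
  have "card I \<le> card (Z \<times> Z)" using IZ finZ by (intro card_mono) auto
  then have cardI: "card I \<le> r * r" using ZA(2) by (simp add: card_cartesian_product)
  have "(\<Union>u\<in>Z. A u) \<subseteq> V" using J W by auto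
  then have "card F \<le> card (\<Union>u\<in>Z. A u)"
    unfolding F_def using finV by (intro card_mono) (auto dest: finite_subset)
  also have "\<dots> = r * s" using star_family_card_UN[OF ZA(1) finV] ZA(2) by simp
  finally have cardF: "card F \<le> r * s" .
  have BW: "?B \<subseteq> W" by (rule bad_set_subset)
  have cardB: "card ?B < m" by (rule W.card_bad_set_less[OF KW K(2)])
  have "card (W - ?B) = card W - card ?B"
    using BW W.finite_W by (simp add: card_Diff_subset finite_subset)
  moreover have "card I * (2 * k) \<le> r * r * (2 * k)" using cardI by (rule mult_right_mono) simp
  ultimately have size: "card F + card I * (2 * k) + 2 * 2 ^ (k + 1) + 7 * m \<le> card (W - ?B)"
    using k(2) cardF cardB by linarith
  have "\<exists>p. (\<forall>i\<in>I. p i \<noteq> [] \<and> hd (p i) = a i \<and> last (p i) = b i \<and> distinct (p i) \<and> set (p i) \<subseteq> W - ?B \<and>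
      successively ?E (p i)) \<and> disjoint_family_on (\<lambda>i. set (p i)) I"
  proof (rule good.route_pairs[OF finI])
    show "F \<subseteq> W - ?B" using J by (auto simp: F_def)
    show "good.extendable F (\<lambda>_. 2)"
      using J K by (intro W.extendable_good KW) (auto simp: F_def)
    show "a ` I \<subseteq> F" "b ` I \<subseteq> F" using gA by (auto simp: a_def b_def I_def)
    show "inj_on a I"
    proof (rule inj_onI)
      fix i j assume "i \<in> I" "j \<in> I" "a i = a j"
      then show "i = j" using g_eq[of "fst i" "snd i" "fst j" "snd j"]
        by (auto simp: a_def I_def case_prod_beta prod_eq_iff)
    qed
    show "inj_on b I"
    proof (rule inj_onI)
      fix i j assume "i \<in> I" "j \<in> I" "b i = b j"
      then show "i = j" using g_eq[of "snd i" "fst i" "snd j" "fst j"]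
        by (auto simp: b_def I_def case_prod_beta prod_eq_iff)
    qed
    show "a ` I \<inter> b ` I = {}"
    proof (rule ccontr)
      assume "\<not> ?thesis"
      then obtain i j where "i \<in> I" "j \<in> I" "a i = b j" by blast
      moreover from this have less: "fst i < snd i" "fst j < snd j" by (auto simp: I_def)
      ultimately have "fst i = snd j \<and> snd i = fst j"
        using less[THEN less_imp_neq] by (intro g_eq) (auto simp: a_def b_def I_def case_prod_beta)
      then show False using less by auto
    qed
  qed (use k size in auto)
  then obtain p where p': "\<forall>i\<in>I. p i \<noteq> [] \<and> hd (p i) = a i \<and> last (p i) = b i \<and> distinct (p i) \<and>
      set (p i) \<subseteq> W - ?B \<and> successively ?E (p i)" and disj: "disjoint_family_on (\<lambda>i. set (p i)) I"
    by blast
  note p = bspec[OF p']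
  let ?H = "\<lparr>pverts = pverts G \<union> pverts (graph_of_slots V X), parcs = parcs G \<union> parcs (graph_of_slots V X)\<rparr>"
  have "contains_clique_subdivision (with_proj ?H) (card Z)"
  proof (rule contains_clique_subdivisionI)
    show "pair_wf_digraph ?H"
      by unfold_locales (auto simp: graph_of_slots_def G dest: G.wellformed')
    show "disjoint_family_on (\<lambda>i. set (p i)) {(u, v). u \<in> Z \<and> v \<in> Z \<and> u < v}"
      using disj by (simp add: I_def)
    fix u v assume uv: "u \<in> Z" "v \<in> Z" "u < v"
    have i: "(u, v) \<in> I" using uv by (simp add: I_def)
    let ?P = "\<lambda>x y. (x, y) \<in> parcs ?H \<and> (y, x) \<in> parcs ?H"
    have "successively ?P (p (u, v))"
      using p[OF i] by (auto simp: graph_of_slots_def adj_def insert_commute elim!: successively_mono)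
    moreover have "g u v \<in> A u" "g v u \<in> A v" using uv by (auto intro: gA)
    then have "(u, g u v) \<in> parcs G" "(v, g v u) \<in> parcs G"
      using ZA(1) uv by (auto simp: star_family_def)
    then have "?P u (hd (p (u, v)))" "?P (last (p (u, v))) v"
      using p[OF i] G.arcs_symmetric by (auto simp: a_def b_def)
    ultimately have "successively ?P (u # p (u, v) @ [v])"
      using p[OF i] by (simp add: successively_Cons successively_append_iff)
    then show "p (u, v) \<noteq> [] \<and> distinct (p (u, v)) \<and> set (p (u, v)) \<subseteq> pverts ?H - Z \<and>
        successively ?P (u # p (u, v) @ [v])"
      using p[OF i] W G by auto
  qed (use finZ ZV G in auto)
  then show ?thesis by (simp only: union_with_proj ZA(2))
qed

text \<open>The first error term bounds the failure of joinedness. The second comes from at most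
  \<open>r * 4 ^ r\<close> sets of \<open>r\<close> leaves, each inside the bad set with probability
  at most \<open>(1 / 16) ^ r\<close>.\<close>

lemma prob_no_clique_subdivision:
  fixes V :: "'a :: linorder set"
  assumes G: "pair_graph G" "pverts G = V" and n: "card V = n" and p: "0 \<le> p" "p \<le> 1"
    and deg: "\<And>v. v \<in> V \<Longrightarrow> 8 * r - 7 \<le> card {w\<in>V. (v, w) \<in> parcs G}" and r: "7 \<le> r"
    and m: "m = n div 64 + 1" and k: "m \<le> 2 ^ k" "2 ^ k \<le> 2 * m" and large: "40 * (r * r) * (k + 1) \<le> n"
  shows "measure_pmf.prob (Pi_pmf (edge_slots V) False (\<lambda>_. bernoulli_pmf p))
      {X. \<not> contains_clique_subdivision (union (with_proj G) (with_proj (graph_of_slots V X))) r}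
    \<le> 4 ^ n * (1 - p) ^ (m * m) + real r * (1 / 4) ^ r"
proof -
  interpret G: pair_graph G by (rule G)
  let ?M = "Pi_pmf (edge_slots V) False (\<lambda>_. bernoulli_pmf p)"
  have finV: "finite V" using G.finite_verts G(2) by simp
  have "40 * (r * r) * 1 \<le> 40 * (r * r) * (k + 1)" by (rule mult_left_mono) auto
  then have rr: "40 * (r * r) \<le> n" using large by linarith
  have r7: "7 * r \<le> r * r" using r by (rule mult_right_mono) simp
  have n_ge: "1960 \<le> n" using rr r7 r by linarith
  have "\<exists>Z A. star_family (\<lambda>x y. (x, y) \<in> parcs G) (2 * r) V V Z A \<and> card Z = r"
  proof (rule star_family_exists[OF finV])
    show "(y, x) \<in> parcs G" if "(x, y) \<in> parcs G" for x y using that by (simp add: G.arcs_symmetric)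
    show "(x, x) \<notin> parcs G" for x using G.no_loops' by blast
    \<comment> \<open>With \<open>2 * r\<close> leaves per star, the degree factor is
      \<open>5 * r - 7\<close>, which is at least \<open>4 * r\<close> because
      \<open>r \<ge> 7\<close>. The other factor is at least
      \<open>40 * (r * r) - 5 * (r * r)\<close>.\<close>
    have "r * (2 * r + 1) * (2 * r) = r * (4 * (r * r) + 2 * r)" by (simp add: algebra_simps)
    also have "\<dots> < r * (35 * (r * r) * 4)" using r r7 by (intro mult_strict_left_mono) linarith+
    also have "\<dots> = (35 * (r * r)) * (4 * r)" by simp
    also have "\<dots> \<le> (card V - r * (2 * (2 * r) + 1)) * (8 * r - 7 - 2 * r - r)"
    proof (rule mult_mono)
      have "r * (2 * (2 * r) + 1) = 4 * (r * r) + r" by (simp add: algebra_simps)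
      then show "35 * (r * r) \<le> card V - r * (2 * (2 * r) + 1)" using n rr r7 by linarith
    qed (use r in auto)
    finally show "r * (2 * r + 1) * (2 * r) < (card V - r * (2 * (2 * r) + 1)) * (8 * r - 7 - 2 * r - r)" .
  qed (rule deg)
  then obtain Z A where ZA: "star_family (\<lambda>x y. (x, y) \<in> parcs G) (2 * r) V V Z A" "card Z = r" by blast
  have Z: "finite Z" "Z \<subseteq> V" and A: "\<And>u. u \<in> Z \<Longrightarrow> A u \<subseteq> V \<and> card (A u) = 2 * r"
    using ZA by (auto simp: star_family_def)
  define W where "W = V - Z"
  define L where "L = (\<Union>u\<in>Z. A u)"
  have LW: "L \<subseteq> W" using ZA(1) by (auto simp: L_def W_def star_family_def)
  have cardW: "card W = n - r" using Z ZA(2) n finV by (simp add: W_def card_Diff_subset)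
  have finW: "finite W" using finV by (simp add: W_def)
  have cardL: "card L = 2 * (r * r)"
    using star_family_card_UN[OF ZA(1) finV] ZA(2) by (simp add: L_def)
  \<comment> \<open>Half of the vertices serve both needs: \<open>16 * m \<le> card J\<close> for
    the factor 1/16, and \<open>10 * m \<le> card K\<close> for the expansion.\<close>
  have "\<exists>J. L \<subseteq> J \<and> J \<subseteq> W \<and> card J = n div 2"
    using LW finW cardL cardW rr r7 by (intro exists_subset_between) linarith+
  then obtain J where J: "L \<subseteq> J" "J \<subseteq> W" "card J = n div 2" by blast
  define K where "K = W - J"
  have finJ: "finite J" using J(2) finW by (rule finite_subset)
  have cardK: "card K = n - r - n div 2"
    using J finJ cardW by (simp add: K_def card_Diff_subset)
  let ?B = "\<lambda>X. bad_set W (adj V X) m K"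
  define bad where "bad T = {X. T \<subseteq> ?B X \<and> card (?B X) < m}" for T
  \<comment> \<open>A star with fewer than \<open>r - 1\<close> leaves outside the bad set has at
    least \<open>r\<close> of its \<open>2 * r\<close> leaves inside it. \<open>TT\<close> lists the
    candidate sets with their centres.\<close>
  define TT where "TT = (SIGMA u:Z. {T. T \<subseteq> A u \<and> card T = r})"
  define nj where "nj = {X. \<exists>A B. A \<subseteq> V \<and> B \<subseteq> V \<and> A \<inter> B = {} \<and> card A = m \<and> card B = m \<and>
    (\<forall>x\<in>A. \<forall>y\<in>B. \<not> adj V X x y)}"
  have finA: "finite (A u)" if "u \<in> Z" for u using A[OF that] finV by (auto dest: finite_subset)
  have finTT: "finite TT" unfolding TT_def using Z finA by (intro finite_SigmaI) auto
  have "card TT = (\<Sum>u\<in>Z. card {T. T \<subseteq> A u \<and> card T = r})"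
    unfolding TT_def using Z finA by (intro card_SigmaI) auto
  also have "\<dots> = (\<Sum>u\<in>Z. 2 * r choose r)" using A finA by (intro sum.cong) (auto simp: n_subsets)
  also have "\<dots> = r * (2 * r choose r)" using ZA(2) by simp
  also have "\<dots> \<le> r * 2 ^ (2 * r)" by (intro mult_left_mono binomial_le_pow2) auto
  finally have cardTT: "card TT \<le> r * 4 ^ r" by (simp add: power_mult)
  have "{X. \<not> contains_clique_subdivision (union (with_proj G) (with_proj (graph_of_slots V X))) r}
      \<subseteq> nj \<union> (\<Union>t\<in>TT. bad (snd t))"
  proof (rule subsetI, rule ccontr)
    fix X assume no: "X \<in> {X. \<not> contains_clique_subdivision (union (with_proj G) (with_proj (graph_of_slots V X))) r}"
      and X: "X \<notin> nj \<union> (\<Union>t\<in>TT. bad (snd t))"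
    have joined: "joined_pairs V m (adj V X)" using X by (auto simp: nj_def joined_pairs_def)
    have m0: "0 < m" using m by simp
    have K10: "10 * m \<le> card K" using cardK m rr r7 n_ge by linarith
    interpret W: joined_graph W "adj V X" m
      by (rule joined_graph_adj) (use finV W_def joined m0 in auto)
    have cardB: "card (?B X) < m" by (rule W.card_bad_set_less[OF _ K10]) (auto simp: K_def)
    have "contains_clique_subdivision (union (with_proj G) (with_proj (graph_of_slots V X))) r"
    proof (rule clique_subdivision_if_good[OF G ZA W_def _ J(2) K_def K10 m0 joined _ k(1)])
      show "(\<Union>u\<in>Z. A u) \<subseteq> J" using J(1) by (simp add: L_def)
      show "r * (2 * r) + r * r * (2 * k) + 2 * 2 ^ (k + 1) + 8 * m \<le> card W"
      proof -
        \<comment> \<open>Leaves and paths take at most \<open>n / 20\<close>, the trees at most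
          \<open>8 * m\<close>, and the reserve another \<open>8 * m\<close>, where
          \<open>16 * m\<close> is about \<open>n / 4\<close>.\<close>
        have "r * (2 * r) + r * r * (2 * k) = 2 * (r * r * (k + 1))" by (simp add: algebra_simps)
        moreover have "40 * (r * r * (k + 1)) \<le> n" using large by (simp only: mult.assoc)
        moreover have "2 * 2 ^ (k + 1) = 4 * (2 ^ k :: nat)" by simp
        ultimately show ?thesis using k(2) m cardW n_ge rr r7 by linarith
      qed
      show "r - 1 \<le> card (A u - ?B X)" if u: "u \<in> Z" for u
      proof (rule ccontr)
        assume less: "\<not> ?thesis"
        have "card (A u) = card (A u - ?B X) + card (A u \<inter> ?B X)"
          using finA[OF u] by (metis add.commute card_Int_Diff)
        then have "r \<le> card (A u \<inter> ?B X)" using less A[OF u] by linarith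
        then obtain T where T: "T \<subseteq> A u \<inter> ?B X" "card T = r" by (meson obtain_subset_with_card_n)
        then have "(u, T) \<in> TT" "X \<in> bad T" using u cardB by (auto simp: TT_def bad_def)
        then show False using X by force
      qed
    qed
    then show False using no by simp
  qed
  then have "measure_pmf.prob ?M {X. \<not> contains_clique_subdivision (union (with_proj G) (with_proj (graph_of_slots V X))) r}
      \<le> measure_pmf.prob ?M (nj \<union> (\<Union>t\<in>TT. bad (snd t)))"
    by (intro measure_pmf.finite_measure_mono) auto
  also have "\<dots> \<le> measure_pmf.prob ?M nj + measure_pmf.prob ?M (\<Union>t\<in>TT. bad (snd t))"
    by (rule measure_Un_le) auto
  also have "measure_pmf.prob ?M nj \<le> 4 ^ n * (1 - p) ^ (m * m)"
    using prob_not_joined[OF finV p, of m] by (simp add: nj_def n)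
  also have "measure_pmf.prob ?M (\<Union>t\<in>TT. bad (snd t)) \<le> (\<Sum>t\<in>TT. measure_pmf.prob ?M (bad (snd t)))"
    using finTT by (intro measure_pmf.finite_measure_subadditive_finite) auto
  also have "\<dots> \<le> (\<Sum>t\<in>TT. (1 / 16) ^ r)"
  proof (rule sum_mono)
    fix t assume t: "t \<in> TT"
    then have "fst t \<in> Z" "snd t \<subseteq> A (fst t)" and card_t: "card (snd t) = r" by (auto simp: TT_def)
    then have T: "snd t \<subseteq> J" "card (snd t) = r" using J(1) unfolding L_def by blast+
    have "measure_pmf.prob ?M (bad (snd t)) \<le> (1 / real 16) ^ card (snd t)"
      unfolding bad_def
    proof (rule prob_subset_bad_set[OF finV _ J(2)])
      show "16 * m \<le> card J" using J(3) m n_ge by linarith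
    qed (use T in \<open>auto simp: K_def W_def\<close>)
    then show "measure_pmf.prob ?M (bad (snd t)) \<le> (1 / 16) ^ r" using T by simp
  qed
  also have "\<dots> = real (card TT) * (1 / 16) ^ r" by simp
  also have "\<dots> \<le> real (r * 4 ^ r) * (1 / 16) ^ r"
    using cardTT by (intro mult_right_mono) (simp_all only: of_nat_le_iff, simp)
  also have "\<dots> = real r * (1 / 4) ^ r"
  proof -
    have "4 ^ r * (1 / 16) ^ r = (1 / 4 :: real) ^ r" by (simp flip: power_mult_distrib)
    then show ?thesis by (simp add: mult.assoc)
  qed
  finally show ?thesis by simp
qed

section \<open>From clique subdivisions to the limit\<close>

lemma tcl_ge:
  assumes "contains_clique_subdivision G r" "finite (verts G)"
  shows "r \<le> tcl G"
  unfolding tcl_def using assms finite_clique_subdivision_orders by (intro Max_ge) auto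

lemma exists_power_two_between:
  assumes "0 < m"
  obtains k where "(m::nat) \<le> 2 ^ k" "2 ^ k < 2 * m"
proof -
  define k where "k = (LEAST k. m \<le> 2 ^ k)"
  have le: "m \<le> 2 ^ k" unfolding k_def by (rule LeastI[of _ m]) (simp add: less_imp_le)
  have "2 ^ k < 2 * m"
  proof (cases k)
    case (Suc l)
    then have "\<not> m \<le> 2 ^ l" using not_less_Least[of l "\<lambda>k. m \<le> 2 ^ k"] by (simp add: k_def)
    then show ?thesis using Suc by simp
  qed (use assms in auto)
  with le show thesis by (rule that)
qed

lemma min_degree_le_card:
  assumes "pair_graph G" "v \<in> pverts G"
  shows "min_degree (with_proj G) \<le> card {w\<in>pverts G. (v, w) \<in> parcs G}"
proof -
  interpret pair_graph G by fact
  have "min_degree (with_proj G) \<le> out_degree (with_proj G) v"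
    unfolding min_degree_def using assms(2) finite_verts by (intro Min_le) auto
  also have "out_arcs (with_proj G) v = Pair v ` {w\<in>pverts G. (v, w) \<in> parcs G}"
    by (auto simp: out_arcs_def dest: wellformed')
  then have "out_degree (with_proj G) v = card {w\<in>pverts G. (v, w) \<in> parcs G}"
    by (simp add: out_degree_def card_image inj_on_def)
  finally show ?thesis .
qed

text \<open>\<open>12288 = 3 * 64 * 64\<close> and \<open>m \<ge> n / 64\<close> give
  \<open>p * m * m \<ge> 3 * n\<close>, so the power of \<open>1 - p\<close> is at most
  \<open>exp (- 3 * n)\<close>, and \<open>exp 3 \<ge> 8\<close> beats the factor
  \<open>4 ^ n\<close>.\<close>

lemma non_edge_power_bound:
  assumes n: "0 < n" and p: "12288 / real n \<le> p" "p \<le> 1" and m: "m = n div 64 + 1"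
  shows "4 ^ n * (1 - p) ^ (m * m) \<le> (1 / 2) ^ n"
proof -
  have "n \<le> 64 * m" unfolding m by presburger
  then have "real n \<le> real (64 * m)" by (simp only: of_nat_le_iff)
  then have "real n / 64 \<le> real m" by simp
  then have sq: "real n / 64 * (real n / 64) \<le> real m * real m" by (intro mult_mono) auto
  have "0 \<le> 12288 / real n" by simp
  then have p0: "0 \<le> p" using p(1) by linarith
  have "12288 / real n * (real n / 64 * (real n / 64)) \<le> p * (real m * real m)"
    by (rule mult_mono[OF p(1) sq p0]) auto
  then have pm: "3 * real n \<le> p * real (m * m)" using n by (simp add: field_simps)
  have "(1 - p) ^ (m * m) \<le> exp (- p) ^ (m * m)"
    using p exp_ge_add_one_self[of "- p"] by (intro power_mono) auto
  also have "\<dots> = exp (- (p * real (m * m)))" by (simp flip: exp_of_nat_mult add: mult.commute)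
  also have "\<dots> \<le> exp (- (3 * real n))" using pm by simp
  also have "\<dots> = exp (- 3) ^ n" by (simp flip: exp_of_nat_mult add: mult.commute)
  also have "\<dots> \<le> (1 / 8) ^ n"
  proof (rule power_mono)
    have "(2::real) ^ 3 \<le> exp 1 ^ 3" using exp_ge_add_one_self[of 1] by (intro power_mono) auto
    then have "(8::real) \<le> exp 3" by (simp flip: exp_of_nat_mult)
    then show "exp (- 3) \<le> (1 / 8 :: real)" by (simp add: exp_minus inverse_eq_divide field_simps)
  qed simp
  finally have "4 ^ n * (1 - p) ^ (m * m) \<le> 4 ^ n * (1 / 8) ^ n" by (intro mult_left_mono) auto
  also have "\<dots> = (1 / 2) ^ n" by (simp flip: power_mult_distrib)
  finally show ?thesis .
qed

text \<open>Rounded up, since \<open>tcl\<close> is an integer that has to reach a real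
  bound.\<close>

definition clique_order :: "nat \<Rightarrow> nat \<Rightarrow> nat" where
  "clique_order n d = nat \<lceil>min (real d / 8) (sqrt (real n / (60 * log 2 (real n))))\<rceil>"

lemma prob_tcl_ge:
  fixes G :: "nat pair_pre_digraph"
  assumes G: "pair_graph G" "card (pverts G) = n"
    and p: "0 \<le> p" "p \<le> 1" "12288 / real n \<le> p" and n: "64 \<le> n"
    and r: "7 \<le> clique_order n (min_degree (with_proj G))" (is "7 \<le> ?r")
  shows "1 - ((1 / 2) ^ n + real ?r * (1 / 4) ^ ?r) \<le>
    measure_pmf.prob (binomial_random_graph (pverts G) p)
      {R. real (tcl (union (with_proj G) (with_proj R)))
         \<ge> min (real (min_degree (with_proj G)) / 8) (sqrt (real n / (60 * log 2 (real n))))}"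
proof -
  interpret pair_graph G by (rule G)
  let ?V = "pverts G" and ?d = "min_degree (with_proj G)"
  let ?x = "min (real ?d / 8) (sqrt (real n / (60 * log 2 (real n))))"
  let ?M = "Pi_pmf (edge_slots ?V) False (\<lambda>_. bernoulli_pmf p)"
  define r where "r = ?r"
  have r7: "7 \<le> r" using r by (simp add: r_def)
  have x_le: "?x \<le> real r" unfolding r_def clique_order_def by linarith
  \<comment> \<open>Rounding up overshoots by less than one. For integers,
    \<open>8 * (r - 1)\<close> below the minimum degree means that the degree is at least
    \<open>8 * r - 7\<close>.\<close>
  have r_less: "real r - 1 < ?x" using r7 unfolding r_def clique_order_def by linarith
  have "8 * (real r - 1) < real ?d" using r_less by simp
  then have "real (8 * r) < real (?d + 8)" by simp
  then have "8 * r < ?d + 8" by (simp only: of_nat_less_iff)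
  then have d: "8 * r - 7 \<le> ?d" by linarith
  define m where "m = n div 64 + 1"
  obtain k where k: "m \<le> 2 ^ k" "2 ^ k < 2 * m"
    using exists_power_two_between[of m] by (auto simp: m_def)
  \<comment> \<open>The power is below \<open>4 * m\<close>, about \<open>n / 16\<close>; this makes
    the tree depth logarithmic.\<close>
  have "2 ^ (k + 1) \<le> n" using k(2) n by (simp add: m_def)
  then have kn: "real (k + 1) \<le> log 2 (real n)" by (rule le_log2_of_power)
  have L: "0 < log 2 (real n)" using kn by linarith
  have "(real r - 1) ^ 2 < (sqrt (real n / (60 * log 2 (real n)))) ^ 2"
    using r_less r7 by (intro power_strict_mono) auto
  also have "\<dots> = real n / (60 * log 2 (real n))" using L by simp
  finally have r2: "60 * log 2 (real n) * (real r - 1) ^ 2 < real n"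
    using L by (simp add: field_simps)
  \<comment> \<open>From \<open>r \<ge> 7\<close> on, lowering the constant 60 to 40 absorbs the
    difference between \<open>r - 1\<close> and \<open>r\<close> caused by rounding.\<close>
  have le: "40 * real r ^ 2 \<le> 60 * (real r - 1) ^ 2"
  proof -
    have "0 \<le> (real r - 7) * (20 * real r + 20)" using r7 by simp
    then show ?thesis using r7 by (simp add: power2_eq_square algebra_simps)
  qed
  have "40 * real r ^ 2 * real (k + 1) \<le> 60 * (real r - 1) ^ 2 * log 2 (real n)"
    by (rule mult_mono[OF le kn]) auto
  also have "\<dots> \<le> real n" using r2 by (simp add: mult_ac)
  finally have "real (40 * (r * r) * (k + 1)) \<le> real n" by (simp add: power2_eq_square algebra_simps)
  then have large: "40 * (r * r) * (k + 1) \<le> n" by (simp only: of_nat_le_iff)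
  define bad where "bad = {X. \<not> contains_clique_subdivision (union (with_proj G) (with_proj (graph_of_slots ?V X))) r}"
  have "measure_pmf.prob ?M bad \<le> 4 ^ n * (1 - p) ^ (m * m) + real r * (1 / 4) ^ r"
    unfolding bad_def
  proof (rule prob_no_clique_subdivision[OF G(1) refl G(2) p(1,2) _ r7 m_def k(1) less_imp_le[OF k(2)] large])
    show "8 * r - 7 \<le> card {w \<in> ?V. (v, w) \<in> parcs G}" if "v \<in> ?V" for v
      using d min_degree_le_card[OF G(1) that] by linarith
  qed
  also have "4 ^ n * (1 - p) ^ (m * m) \<le> (1 / 2) ^ n"
    using n p by (intro non_edge_power_bound m_def) auto
  finally have bad: "measure_pmf.prob ?M bad \<le> (1 / 2) ^ n + real r * (1 / 4) ^ r" by simp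
  have good: "?x \<le> real (tcl (union (with_proj G) (with_proj (graph_of_slots ?V X))))" if "X \<notin> bad" for X
  proof -
    have "r \<le> tcl (union (with_proj G) (with_proj (graph_of_slots ?V X)))"
    proof (rule tcl_ge)
      show "finite (verts (union (with_proj G) (with_proj (graph_of_slots ?V X))))"
        using finite_verts by (simp add: union_with_proj graph_of_slots_def)
    qed (use that in \<open>simp add: bad_def\<close>)
    then show ?thesis using x_le by linarith
  qed
  have "1 - ((1 / 2) ^ n + real r * (1 / 4) ^ r) \<le> 1 - measure_pmf.prob ?M bad" using bad by simp
  also have "\<dots> = measure_pmf.prob ?M (- bad)"
    using measure_pmf.prob_compl[of bad ?M] by (simp add: Compl_eq_Diff_UNIV)
  also have "\<dots> \<le> measure_pmf.prob ?M (graph_of_slots ?V -`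
      {R. ?x \<le> real (tcl (union (with_proj G) (with_proj R)))})"
    using good by (intro measure_pmf.finite_measure_mono) auto
  also have "\<dots> = measure_pmf.prob (binomial_random_graph ?V p)
      {R. ?x \<le> real (tcl (union (with_proj G) (with_proj R)))}"
    by (simp add: binomial_random_graph_conv)
  finally show ?thesis by (simp only: r_def)
qed

lemma filterlim_clique_order:
  assumes "filterlim d at_top sequentially"
  shows "filterlim (\<lambda>n. clique_order n (d n)) at_top sequentially"
proof -
  have s: "filterlim (\<lambda>n. sqrt (real n / (60 * log 2 (real n)))) at_top sequentially"
    by real_asymp
  show ?thesis
    unfolding filterlim_at_top
  proof
    fix c :: nat
    have "\<forall>\<^sub>F n in sequentially. 8 * c \<le> d n"
      using assms by (simp add: filterlim_at_top)
    moreover have "\<forall>\<^sub>F n in sequentially. real c \<le> sqrt (real n / (60 * log 2 (real n)))"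
      using s by (simp only: filterlim_at_top)
    ultimately show "\<forall>\<^sub>F n in sequentially. c \<le> clique_order n (d n)"
    proof eventually_elim
      case (elim n)
      then have "real c \<le> min (real (d n) / 8) (sqrt (real n / (60 * log 2 (real n))))" by simp
      then show ?case unfolding clique_order_def by linarith
    qed
  qed
qed

theorem theorem1p5:
  shows "\<exists>C::real. C > 0 \<and>
    (\<forall>(G :: nat \<Rightarrow> nat pair_pre_digraph) (p :: nat \<Rightarrow> real).
       (\<forall>n. pair_graph (G n) \<and> card (pverts (G n)) = n) \<longrightarrow>
       filterlim (\<lambda>n. min_degree (with_proj (G n))) at_top sequentially \<longrightarrow>
       (\<forall>n. 0 \<le> p n \<and> p n \<le> 1) \<longrightarrow>
       (\<forall>\<^sub>F n in sequentially. p n \<ge> C / real n) \<longrightarrow>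
       (\<lambda>n. measure_pmf.prob (binomial_random_graph (pverts (G n)) (p n))
              {R. real (tcl (union (with_proj (G n)) (with_proj R)))
                    \<ge> min (real (min_degree (with_proj (G n))) / 8)
                          (sqrt (real n / (60 * log 2 (real n))))})
         \<longlonglongrightarrow> 1)"
proof (intro exI[of _ 12288] conjI allI impI)
  fix G :: "nat \<Rightarrow> nat pair_pre_digraph" and p :: "nat \<Rightarrow> real"
  assume G: "\<forall>n. pair_graph (G n) \<and> card (pverts (G n)) = n"
    and \<delta>: "filterlim (\<lambda>n. min_degree (with_proj (G n))) at_top sequentially"
    and p: "\<forall>n. 0 \<le> p n \<and> p n \<le> 1" "\<forall>\<^sub>F n in sequentially. p n \<ge> 12288 / real n"
  define r where "r n = clique_order n (min_degree (with_proj (G n)))" for n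
  have r: "filterlim r at_top sequentially"
    unfolding r_def[abs_def] by (rule filterlim_clique_order[OF \<delta>])
  let ?P = "\<lambda>n. measure_pmf.prob (binomial_random_graph (pverts (G n)) (p n))
              {R. real (tcl (union (with_proj (G n)) (with_proj R)))
                    \<ge> min (real (min_degree (with_proj (G n))) / 8)
                          (sqrt (real n / (60 * log 2 (real n))))}"
  show "?P \<longlonglongrightarrow> 1"
  proof (rule tendsto_sandwich)
    have "\<forall>\<^sub>F n in sequentially. 7 \<le> r n" using r by (simp add: filterlim_at_top)
    then show "\<forall>\<^sub>F n in sequentially. 1 - ((1 / 2) ^ n + real (r n) * (1 / 4) ^ r n) \<le> ?P n"
      using p(2) eventually_ge_at_top[of "64::nat"]
    proof eventually_elim
      case (elim n)
      then show ?case using G p(1) unfolding r_def by (intro prob_tcl_ge) auto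
    qed
    \<comment> \<open>The error depends on \<open>r n\<close>, not on \<open>n\<close>; it vanishes
      because \<open>r n\<close> tends to infinity, and here the growth of the minimum degree
      enters.\<close>
    have "(\<lambda>n. real n * (1 / 4) ^ n) \<longlonglongrightarrow> 0" by real_asymp
    then have "(\<lambda>n. real (r n) * (1 / 4) ^ r n) \<longlonglongrightarrow> 0" by (rule filterlim_compose[OF _ r])
    moreover have "(\<lambda>n. (1 / 2 :: real) ^ n) \<longlonglongrightarrow> 0" by real_asymp
    ultimately have "(\<lambda>n. 1 - ((1 / 2) ^ n + real (r n) * (1 / 4) ^ r n)) \<longlonglongrightarrow> 1 - (0 + 0)"
      by (intro tendsto_diff tendsto_add tendsto_const)
    then show "(\<lambda>n. 1 - ((1 / 2) ^ n + real (r n) * (1 / 4) ^ r n)) \<longlonglongrightarrow> 1" by simp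
  qed auto
qed simp

end
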